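(* Let $M=\mathbb{S}^3\subset\mathbb{R}^4$ be the $3$-dimensional unit sphere (centered at the origin) equipped with the canonical Riemannian metric $g$ of curvature $1$, and let $Y_2$ be the unit Killing vector field $$Y_2=-y_1\partial_{x_1}+x_1\partial_{y_1}-y_2\partial_{x_2}+x_2\partial_{y_2}$$ on $\mathbb{S}^3=\{(z_1,z_2)=(x_1+iy_1,x_2+iy_2)\in\mathbb{C}^2:|z_1|^2+|z_2|^2=1\}$. Then for all sufficiently small $t>0$ one has, for $\alpha=tY_2$, $$\lambda_{1,1}^\alpha(M)<\lambda_{1,1}(M),$$ so the diamagnetic inequality does not hold in general for differential $1$-forms.
   Context: Vector fields and $1$-forms are identified via the metric. For a real $1$-form $\alpha$ with dual vector field $\alpha^\sharp$: $d^\alpha=d^M+i\alpha\wedge$, $\delta^\alpha=\delta^M-i\alpha^\sharp\lrcorner$ ($\delta^M$ the formal adjoint of $d^M$), and $\Delta^\alpha=d^\alpha\delta^\alpha+\delta^\alpha d^\alpha$ on smooth complex $p$-forms; $\lambda_{1,p}^\alpha(M)$ is its smallest eigenvalue. $\lambda_{1,p}(M)$ is the smallest eigenvalue of the Hodge Laplacian $\Delta^M=d^M\delta^M+\delta^Md^M$ on $p$-forms. The diamagnetic inequality is $\lambda_{1,p}^\alpha(M)\ge\lambda_{1,p}(M)$. *)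

theory Defs
  imports "HOL-Analysis.Analysis"
begin

section \<open>Smooth maps\<close>

text \<open>Both notions are meant for open domains \<open>S\<close>.\<close>

fun Ck_on :: "nat \<Rightarrow> ('a::euclidean_space \<Rightarrow> 'b::real_normed_vector) \<Rightarrow> 'a set \<Rightarrow> bool" where
  "Ck_on 0 f S \<longleftrightarrow> continuous_on S f"
| "Ck_on (Suc k) f S \<longleftrightarrow>
     f differentiable_on S \<and> (\<forall>v. Ck_on k (\<lambda>x. frechet_derivative f (at x) v) S)"

definition smooth_on :: "('a::euclidean_space \<Rightarrow> 'b::real_normed_vector) \<Rightarrow> 'a set \<Rightarrow> bool" where
  "smooth_on f S \<longleftrightarrow> (\<forall>k. Ck_on k f S)"

section \<open>The unit sphere in four-space\<close>

abbreviation S3 :: "(real^4) set" where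
  "S3 \<equiv> sphere 0 1"

definition tangent_space :: "real^4 \<Rightarrow> (real^4) set" where
  "tangent_space x = {v. v \<bullet> x = 0}"

text \<open>The integral over \<open>S3\<close> with respect to the Riemannian volume of the metric induced from
  four-space. In polar coordinates the integral of \<open>f (x / norm x)\<close> over the unit ball is
  the integral of \<open>f\<close> over the sphere times that of \<open>r ^ 3\<close> over \<open>[0, 1]\<close>, whence the factor 4.
  The centre of the ball, where \<open>sgn x \<notin> S3\<close>, is a null set.\<close>

definition sphere_integral :: "(real^4 \<Rightarrow> complex) \<Rightarrow> complex" where
  "sphere_integral f = 4 * (LINT x:ball 0 1|lborel. f (sgn x))"

text \<open>Vector fields on \<open>S3\<close> are total functions of which only the values on \<open>S3\<close> matter;
  smoothness is that of the extension constant along rays.\<close>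

definition smooth_vector_field :: "(real^4 \<Rightarrow> real^4) \<Rightarrow> bool" where
  "smooth_vector_field X \<longleftrightarrow>
     (\<forall>x\<in>S3. X x \<in> tangent_space x) \<and> smooth_on (\<lambda>x. X (sgn x)) (- {0})"

section \<open>Complex differential forms on the sphere\<close>

text \<open>A \<open>p\<close>-form assigns to \<open>x \<in> S3\<close> and a list of \<open>p\<close> tangent vectors at \<open>x\<close> a complex number. It is
  set to 0 on all other arguments, so that equality of forms is equality of functions.\<close>

type_synonym cform = "real^4 \<Rightarrow> (real^4) list \<Rightarrow> complex"

definition alternating_form :: "nat \<Rightarrow> cform \<Rightarrow> bool" where
  "alternating_form p \<omega> \<longleftrightarrow>
     (\<forall>x vs. \<not> (x \<in> S3 \<and> length vs = p \<and> set vs \<subseteq> tangent_space x) \<longrightarrow> \<omega> x vs = 0) \<and>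
     (\<forall>x\<in>S3. \<forall>vs. length vs = p \<and> set vs \<subseteq> tangent_space x \<longrightarrow>
        (\<forall>i<p. \<forall>u\<in>tangent_space x. \<forall>w\<in>tangent_space x. \<forall>a b :: real.
           \<omega> x (vs[i := a *\<^sub>R u + b *\<^sub>R w])
             = of_real a * \<omega> x (vs[i := u]) + of_real b * \<omega> x (vs[i := w])) \<and>
        (\<forall>i<p. \<forall>j<p. i \<noteq> j \<and> vs ! i = vs ! j \<longrightarrow> \<omega> x vs = 0))"

text \<open>The pullback of a form along the retraction \<open>sgn\<close>, \<open>y \<mapsto> y / norm y\<close>, of the punctured space
  onto \<open>S3\<close>. The derivative of this retraction at \<open>y\<close> is \<open>v \<mapsto> (v - (v \<bullet> sgn y) sgn y) / norm y\<close>;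
  at a point of \<open>S3\<close> it is the orthogonal projection onto the tangent space.\<close>

definition radial_pullback :: "cform \<Rightarrow> cform" where
  "radial_pullback \<omega> y vs = \<omega> (sgn y) (map (\<lambda>v. (v - (v \<bullet> sgn y) *\<^sub>R sgn y) /\<^sub>R norm y) vs)"

definition smooth_forms :: "nat \<Rightarrow> cform set" where
  "smooth_forms p =
     {\<omega>. alternating_form p \<omega> \<and> (\<forall>vs. smooth_on (\<lambda>y. radial_pullback \<omega> y vs) (- {0}))}"

definition drop_nth :: "nat \<Rightarrow> 'a list \<Rightarrow> 'a list" where
  "drop_nth i vs = take i vs @ drop (Suc i) vs"

text \<open>The retraction is a left inverse of the inclusion of \<open>S3\<close>, so the differential of \<open>\<omega>\<close> is the
  restriction to \<open>S3\<close> of the Euclidean exterior derivative of \<open>radial_pullback \<omega>\<close>.\<close>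

definition ext_deriv :: "cform \<Rightarrow> cform" where
  "ext_deriv \<omega> x vs =
     (if x \<in> S3 \<and> set vs \<subseteq> tangent_space x
      then \<Sum>i<length vs. (-1) ^ i *
             frechet_derivative (\<lambda>y. radial_pullback \<omega> y (drop_nth i vs)) (at x) (vs ! i)
      else 0)"

text \<open>In the next two operations the vector field \<open>X\<close> also stands for the dual real 1-form.\<close>

definition wedge_field :: "(real^4 \<Rightarrow> real^4) \<Rightarrow> cform \<Rightarrow> cform" where
  "wedge_field X \<omega> x vs =
     (if x \<in> S3 \<and> set vs \<subseteq> tangent_space x
      then \<Sum>i<length vs. (-1) ^ i * of_real (X x \<bullet> (vs ! i)) * \<omega> x (drop_nth i vs)
      else 0)"

definition contract_field :: "(real^4 \<Rightarrow> real^4) \<Rightarrow> cform \<Rightarrow> cform" where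
  "contract_field X \<omega> x vs = \<omega> x (X x # vs)"

text \<open>The pointwise Hermitian product sums over increasing multi-indices of a tangent orthonormal
  basis. Summing instead over all \<open>p\<close>-tuples counts each term \<open>p!\<close> times, and that sum does not
  change if the tangent basis is replaced by the projections of an orthonormal basis
  of four-space.\<close>

definition form_inner :: "nat \<Rightarrow> cform \<Rightarrow> cform \<Rightarrow> real^4 \<Rightarrow> complex" where
  "form_inner p \<omega> \<eta> x =
     (\<Sum>es | length es = p \<and> set es \<subseteq> Basis. radial_pullback \<omega> x es * cnj (radial_pullback \<eta> x es))
       / fact p"

definition L2_inner :: "nat \<Rightarrow> cform \<Rightarrow> cform \<Rightarrow> complex" where
  "L2_inner p \<omega> \<eta> = sphere_integral (form_inner p \<omega> \<eta>)"

text \<open>\<open>codiff p\<close> acts on \<open>p\<close>-forms: it is the formal adjoint of the differential on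
  \<open>(p - 1)\<close>-forms.\<close>

fun codiff :: "nat \<Rightarrow> cform \<Rightarrow> cform" where
  "codiff 0 \<omega> = (\<lambda>x vs. 0)"
| "codiff (Suc p) \<omega> =
     (THE \<eta>. \<eta> \<in> smooth_forms p \<and>
        (\<forall>\<phi>\<in>smooth_forms p. L2_inner (Suc p) (ext_deriv \<phi>) \<omega> = L2_inner p \<phi> \<eta>))"

section \<open>Hodge and magnetic Hodge Laplacians\<close>

definition hodge_laplacian :: "nat \<Rightarrow> cform \<Rightarrow> cform" where
  "hodge_laplacian p \<omega> =
     (\<lambda>x vs. ext_deriv (codiff p \<omega>) x vs + codiff (Suc p) (ext_deriv \<omega>) x vs)"

definition magnetic_deriv :: "(real^4 \<Rightarrow> real^4) \<Rightarrow> cform \<Rightarrow> cform" where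
  "magnetic_deriv X \<omega> = (\<lambda>x vs. ext_deriv \<omega> x vs + \<i> * wedge_field X \<omega> x vs)"

definition magnetic_codiff :: "(real^4 \<Rightarrow> real^4) \<Rightarrow> nat \<Rightarrow> cform \<Rightarrow> cform" where
  "magnetic_codiff X p \<omega> = (\<lambda>x vs. codiff p \<omega> x vs - \<i> * contract_field X \<omega> x vs)"

definition magnetic_laplacian :: "(real^4 \<Rightarrow> real^4) \<Rightarrow> nat \<Rightarrow> cform \<Rightarrow> cform" where
  "magnetic_laplacian X p \<omega> =
     (\<lambda>x vs. magnetic_deriv X (magnetic_codiff X p \<omega>) x vs
           + magnetic_codiff X (Suc p) (magnetic_deriv X \<omega>) x vs)"

definition eigenvalues :: "nat \<Rightarrow> (cform \<Rightarrow> cform) \<Rightarrow> real set" where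
  "eigenvalues p L =
     {c. \<exists>\<omega>\<in>smooth_forms p. \<omega> \<noteq> (\<lambda>x vs. 0) \<and> L \<omega> = (\<lambda>x vs. of_real c * \<omega> x vs)}"

text \<open>The Laplacians above are nonnegative and symmetric with discrete spectrum, so
  the infimum is attained and is the smallest eigenvalue.\<close>

definition smallest_eigenvalue :: "nat \<Rightarrow> (cform \<Rightarrow> cform) \<Rightarrow> real" where
  "smallest_eigenvalue p L = Inf (eigenvalues p L)"

definition hodge_lambda1 :: "nat \<Rightarrow> real" where
  "hodge_lambda1 p = smallest_eigenvalue p (hodge_laplacian p)"

definition magnetic_lambda1 :: "(real^4 \<Rightarrow> real^4) \<Rightarrow> nat \<Rightarrow> real" where
  "magnetic_lambda1 X p = smallest_eigenvalue p (magnetic_laplacian X p)"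

section \<open>The Hopf field\<close>

text \<open>The coordinates are ordered \<open>(x\<^sub>1, y\<^sub>1, x\<^sub>2, y\<^sub>2)\<close>.\<close>

definition Y2 :: "real^4 \<Rightarrow> real^4" where
  "Y2 x = vector [- (x $ 2), x $ 1, - (x $ 4), x $ 3]"

lemma Y2_nth:
  "Y2 x $ 1 = - (x $ 2)" "Y2 x $ 2 = x $ 1" "Y2 x $ 3 = - (x $ 4)" "Y2 x $ 4 = x $ 3"
  by (simp_all add: Y2_def vector_def)

lemma Y2_unit_tangent:
  assumes "x \<in> S3"
  shows "Y2 x \<in> tangent_space x" and "norm (Y2 x) = 1"
  using assms
  by (auto simp: Y2_nth tangent_space_def inner_vec_def norm_eq_sqrt_inner sum_4 algebra_simps)

text \<open>\<open>Y2\<close> is linear and its covariant derivative in direction \<open>u\<close> is the tangential part of \<open>Y2 u\<close>,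
  so the following is the Killing equation.\<close>

lemma Y2_Killing:
  "linear Y2" "Y2 u \<bullet> v + u \<bullet> Y2 v = 0"
  by (auto intro!: linearI simp: Y2_nth vec_eq_iff forall_4 inner_vec_def sum_4 algebra_simps)

end

theory Submission
  imports Defs
begin

text \<open>
  On the sphere the first eigenvalue of the Hodge Laplacian on 1-forms is 3, attained at the
  differentials of linear functions, whereas the differential of \<open>cnj z\<^sub>1\<close> is an eigenform of the
  magnetic Laplacian for \<open>t Y2\<close> with eigenvalue \<open>3 - 2 t + t\<^sup>2\<close>, which is below 3 for \<open>0 < t < 2\<close>.
  The reason is that for a Killing field of constant length 1 the magnetic Laplacian is
  \<open>\<Delta> - 2 \<i> t L + t\<^sup>2\<close>, with \<open>L\<close> the Lie derivative along the field, and \<open>L\<close> commutes with \<open>\<Delta>\<close>;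
  on a suitable eigenform the linear term is negative.

  All computations take place in a global orthonormal frame \<open>E\<^sub>1 = Y2\<close>, \<open>E\<^sub>2\<close>, \<open>E\<^sub>3\<close> of the tangent
  bundle consisting of Killing fields, restrictions of skew linear maps that multiply like the
  quaternion units. It satisfies \<open>[E\<^sub>a, E\<^sub>a\<^sub>+\<^sub>1] = 2 E\<^sub>a\<^sub>+\<^sub>2\<close> with indices modulo 3
  (\<open>frame_deriv_commute\<close>). Smooth 0-forms and 1-forms become one or three smooth functions, and the
  exterior derivative becomes a gradient or a curl (\<open>ext_deriv_form0\<close>, \<open>ext_deriv_form1\<close>). The flow of
  each \<open>E\<^sub>a\<close> is by rotations, so derivatives along the frame integrate to 0
  (\<open>sphere_integral_frame_deriv\<close>); therefore the codifferentials exist and are minus the divergence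
  and the curl (\<open>codiff_form1\<close>, \<open>codiff_form2\<close>). The potential \<open>t Y2\<close> merely replaces \<open>E\<^sub>1\<close> by
  \<open>E\<^sub>1 + \<i> t\<close>, and the eigenform is checked by algebra in the span of \<open>cnj z\<^sub>1\<close> and \<open>z\<^sub>2\<close>
  (\<open>mag_lap_sph_grad\<close>).

  Two lower bounds are needed to compare infima. The magnetic spectrum is nonnegative, by the energy
  identity \<open>mag_energy\<close>. A Hodge eigenvalue on 1-forms is at least 3 by the Bochner formula together
  with the estimate of the symmetrised gradient by its trace (\<open>bochner_inequality\<close>,
  \<open>hodge_eigenvalue_ge_3\<close>).
\<close>

section \<open>Smooth maps on open sets\<close>

lemma Ck_on_cong:
  assumes "open S" "\<And>x. x \<in> S \<Longrightarrow> f x = g x" "Ck_on k f S"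
  shows "Ck_on k g S"
  using assms(2,3)
proof (induction k arbitrary: f g)
  case 0
  then show ?case by (auto cong: continuous_on_cong_simp)
next
  case (Suc k)
  have fd: "f differentiable at x" if "x \<in> S" for x
    using Suc.prems(2) that assms(1) by (simp add: differentiable_on_eq_differentiable_at)
  have eq: "frechet_derivative f (at x) = frechet_derivative g (at x)" if "x \<in> S" for x
    using frechet_derivative_transform_within_open[OF fd[OF that] assms(1) that] Suc.prems(1) by blast
  have "Ck_on k (\<lambda>x. frechet_derivative g (at x) v) S" for v
    by (rule Suc.IH[where f = "\<lambda>x. frechet_derivative f (at x) v"]) (use eq Suc.prems(2) in auto)
  moreover have "g differentiable_on S"
    unfolding differentiable_on_def
    by (meson Suc.prems differentiable_on_def Ck_on.simps(2) differentiable_transform_within zero_less_one)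
  ultimately show ?case by simp
qed

lemma Ck_on_SucI:
  assumes "open S" "\<And>x. x \<in> S \<Longrightarrow> (f has_derivative f' x) (at x)" "\<And>v. Ck_on k (\<lambda>x. f' x v) S"
  shows "Ck_on (Suc k) f S"
proof -
  have "f differentiable_on S"
    using assms(1,2) differentiable_def differentiable_on_eq_differentiable_at by blast
  moreover have "Ck_on k (\<lambda>x. frechet_derivative f (at x) v) S" for v
    by (rule Ck_on_cong[OF assms(1) _ assms(3)]) (use frechet_derivative_at[OF assms(2)] in simp)
  ultimately show ?thesis by simp
qed

lemma Ck_on_Suc_has_derivative:
  assumes "open S" "Ck_on (Suc k) f S" "x \<in> S"
  shows "(f has_derivative frechet_derivative f (at x)) (at x)"
  using assms by (simp add: differentiable_on_eq_differentiable_at frechet_derivative_works)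

lemma Ck_on_pred: "Ck_on (Suc k) f S \<Longrightarrow> Ck_on k f S"
  by (induction k arbitrary: f) (auto intro: differentiable_imp_continuous_on)

lemma Ck_on_const: "open S \<Longrightarrow> Ck_on k (\<lambda>x. c) S"
proof (induction k arbitrary: c)
  case (Suc k)
  then show ?case by (intro Ck_on_SucI[where f' = "\<lambda>_ _. 0"]) auto
qed auto

lemma Ck_on_add:
  assumes "open S" "Ck_on k f S" "Ck_on k g S"
  shows "Ck_on k (\<lambda>x. f x + g x) S"
  using assms(2,3)
proof (induction k arbitrary: f g)
  case (Suc k)
  show ?case
  proof (rule Ck_on_SucI[OF assms(1)])
    show "((\<lambda>x. f x + g x) has_derivative
        (\<lambda>v. frechet_derivative f (at x) v + frechet_derivative g (at x) v)) (at x)" if "x \<in> S" for x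
      by (intro has_derivative_add Ck_on_Suc_has_derivative[OF assms(1) Suc.prems(1)]
          Ck_on_Suc_has_derivative[OF assms(1) Suc.prems(2)] that)
  qed (use Suc in auto)
qed (auto intro: continuous_on_add)

lemma Ck_on_bounded_bilinear:
  assumes "bounded_bilinear B" "open S" "Ck_on k f S" "Ck_on k g S"
  shows "Ck_on k (\<lambda>x. B (f x) (g x)) S"
  using assms(3,4)
proof (induction k arbitrary: f g)
  case 0
  then show ?case using bounded_bilinear.continuous_on[OF assms(1)] by auto
next
  case (Suc k)
  show ?case
  proof (rule Ck_on_SucI[OF assms(2)])
    show "((\<lambda>x. B (f x) (g x)) has_derivative
        (\<lambda>v. B (f x) (frechet_derivative g (at x) v) + B (frechet_derivative f (at x) v) (g x))) (at x)"
      if "x \<in> S" for x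
      by (intro bounded_bilinear.FDERIV[OF assms(1)]
          Ck_on_Suc_has_derivative[OF assms(2) Suc.prems(1)] Ck_on_Suc_has_derivative[OF assms(2) Suc.prems(2)] that)
    show "Ck_on k (\<lambda>x. B (f x) (frechet_derivative g (at x) v) + B (frechet_derivative f (at x) v) (g x)) S" for v
      using Suc.prems Suc.prems[THEN Ck_on_pred] by (intro Ck_on_add assms(2) Suc.IH) simp_all
  qed
qed

lemma Ck_on_bounded_linear:
  assumes "bounded_linear L" "open S" "Ck_on k f S"
  shows "Ck_on k (\<lambda>x. L (f x)) S"
  using assms(3)
proof (induction k arbitrary: f)
  case 0
  then show ?case using bounded_linear.continuous_on[OF assms(1)] by auto
next
  case (Suc k)
  show ?case
    by (rule Ck_on_SucI[OF assms(2)])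
      (use Suc Ck_on_Suc_has_derivative[OF assms(2) Suc.prems] in
        \<open>auto intro!: bounded_linear.has_derivative[OF assms(1)]\<close>)
qed

lemma Ck_on_ident:
  assumes "open S"
  shows "Ck_on k (\<lambda>x. x) S"
proof (cases k)
  case (Suc m)
  then show ?thesis
    by (auto intro!: Ck_on_SucI[OF assms, where f' = "\<lambda>_ v. v"] Ck_on_const[OF assms])
qed auto

lemma has_derivative_inverse_norm:
  fixes x :: "'a::real_inner"
  assumes "x \<noteq> 0"
  shows "((\<lambda>x. inverse (norm x)) has_derivative
    (\<lambda>v. - (inverse (norm x) * ((x \<bullet> v) * (inverse (norm x) * inverse (norm x)))))) (at x)"
proof -
  have "(norm has_derivative (\<lambda>v. v \<bullet> sgn x)) (at x)"
    using assms has_derivative_norm by auto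
  from Deriv.has_derivative_inverse[OF _ this] assms show ?thesis
    by (simp add: sgn_div_norm inner_commute mult_ac)
qed

text \<open>The partial derivatives of the inverse norm are polynomials in the coordinates and in the inverse
  norm itself, so smoothness follows by induction on the order.\<close>

lemma Ck_on_inverse_norm: "Ck_on k (\<lambda>x::'a::euclidean_space. inverse (norm x)) (- {0})"
proof (induction k)
  case 0
  then show ?case by (auto intro!: continuous_intros)
next
  case (Suc k)
  have o: "open (- {0::'a})" by auto
  let ?r = "\<lambda>x::'a. inverse (norm x)"
  show ?case
  proof (rule Ck_on_SucI[OF o])
    show "(?r has_derivative (\<lambda>v. - (?r x * ((x \<bullet> v) * (?r x * ?r x))))) (at x)" if "x \<in> - {0}" for x
      using has_derivative_inverse_norm that by blast
    show "Ck_on k (\<lambda>x. - (?r x * ((x \<bullet> v) * (?r x * ?r x)))) (- {0})" for v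
      by (intro Ck_on_bounded_linear[OF bounded_linear_minus[OF bounded_linear_ident]]
          Ck_on_bounded_bilinear[OF bounded_bilinear_mult] Suc o
          Ck_on_bounded_linear[OF bounded_linear_inner_left] Ck_on_ident)
  qed
qed

lemma smooth_on_cong:
  "open S \<Longrightarrow> smooth_on f S \<Longrightarrow> (\<And>x. x \<in> S \<Longrightarrow> f x = g x) \<Longrightarrow> smooth_on g S"
  unfolding smooth_on_def using Ck_on_cong by blast

lemma smooth_on_const: "open S \<Longrightarrow> smooth_on (\<lambda>x. c) S"
  by (simp add: smooth_on_def Ck_on_const)

lemma smooth_on_add:
  "open S \<Longrightarrow> smooth_on f S \<Longrightarrow> smooth_on g S \<Longrightarrow> smooth_on (\<lambda>x. f x + g x) S"
  by (simp add: smooth_on_def Ck_on_add)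

lemma smooth_on_sum:
  assumes "open S" "\<And>i. i \<in> I \<Longrightarrow> smooth_on (f i) S"
  shows "smooth_on (\<lambda>x. \<Sum>i\<in>I. f i x) S"
  using assms(2)
  by (induction I rule: infinite_finite_induct) (auto intro: smooth_on_const smooth_on_add assms(1))

lemma smooth_on_bounded_bilinear:
  "bounded_bilinear B \<Longrightarrow> open S \<Longrightarrow> smooth_on f S \<Longrightarrow> smooth_on g S \<Longrightarrow> smooth_on (\<lambda>x. B (f x) (g x)) S"
  by (simp add: smooth_on_def Ck_on_bounded_bilinear)

lemma smooth_on_bounded_linear:
  "bounded_linear L \<Longrightarrow> open S \<Longrightarrow> smooth_on f S \<Longrightarrow> smooth_on (\<lambda>x. L (f x)) S"
  by (simp add: smooth_on_def Ck_on_bounded_linear)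

lemma smooth_on_linear: "bounded_linear L \<Longrightarrow> open S \<Longrightarrow> smooth_on L S"
  using smooth_on_bounded_linear[of L S "\<lambda>x. x"] by (simp add: smooth_on_def Ck_on_ident)

lemma smooth_on_inverse_norm: "smooth_on (\<lambda>x::'a::euclidean_space. inverse (norm x)) (- {0})"
  by (simp add: smooth_on_def Ck_on_inverse_norm)

lemma smooth_on_frechet_derivative:
  "smooth_on f S \<Longrightarrow> smooth_on (\<lambda>x. frechet_derivative f (at x) v) S"
  unfolding smooth_on_def using Ck_on.simps(2) by blast

lemma smooth_on_has_derivative:
  "open S \<Longrightarrow> smooth_on f S \<Longrightarrow> x \<in> S \<Longrightarrow> (f has_derivative frechet_derivative f (at x)) (at x)"
  unfolding smooth_on_def using Ck_on_Suc_has_derivative by blast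

lemma smooth_on_continuous_on: "smooth_on f S \<Longrightarrow> continuous_on S f"
  unfolding smooth_on_def using Ck_on.simps(1) by blast

text \<open>The second difference of \<open>f\<close> over the parallelogram spanned by \<open>h u\<close> and \<open>h v\<close> is, by the mean
  value theorem applied first along \<open>u\<close> and then along \<open>v\<close>, equal to \<open>h\<^sup>2\<close> times an iterated
  derivative at a nearby point.\<close>

lemma second_difference_mean_value:
  fixes f :: "'a::euclidean_space \<Rightarrow> real"
  assumes f: "\<And>y. y \<in> ball x e \<Longrightarrow> (f has_derivative f' y) (at y)"
    and f': "\<And>y. y \<in> ball x e \<Longrightarrow> ((\<lambda>z. f' z u) has_derivative f'' y) (at y)"
    and h: "0 < h" "h * (norm u + norm v) < e"
  shows "\<exists>y. dist x y \<le> h * (norm u + norm v) \<and>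
     f (x + h *\<^sub>R u + h *\<^sub>R v) - f (x + h *\<^sub>R u) - f (x + h *\<^sub>R v) + f x = h * h * f'' y v"
proof -
  have near: "dist x (x + s *\<^sub>R u + t *\<^sub>R v) \<le> h * (norm u + norm v)"
    if "0 \<le> s" "s \<le> h" "0 \<le> t" "t \<le> h" for s t
  proof -
    have "norm (s *\<^sub>R u + t *\<^sub>R v) \<le> s * norm u + t * norm v"
      using norm_triangle_ineq[of "s *\<^sub>R u" "t *\<^sub>R v"] that by simp
    also have "\<dots> \<le> h * norm u + h * norm v"
      using that by (intro add_mono mult_right_mono) auto
    finally show ?thesis by (simp add: dist_norm norm_minus_commute algebra_simps)
  qed
  have inb: "x + s *\<^sub>R u + t *\<^sub>R v \<in> ball x e"
    if "0 \<le> s" "s \<le> h" "0 \<le> t" "t \<le> h" for s t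
    using near[OF that] h by auto
  define \<phi> where "\<phi> s = f (x + s *\<^sub>R u + h *\<^sub>R v) - f (x + s *\<^sub>R u)" for s
  have "\<exists>\<sigma>\<in>{0<..<h}. \<phi> h - \<phi> 0 = (\<lambda>d. f' (x + \<sigma> *\<^sub>R u + h *\<^sub>R v) (d *\<^sub>R u) - f' (x + \<sigma> *\<^sub>R u) (d *\<^sub>R u)) (h - 0)"
  proof (rule mvt_simple)
    fix s assume s: "0 \<le> s" "s \<le> h"
    have 1: "((\<lambda>s. f (x + s *\<^sub>R u + h *\<^sub>R v)) has_derivative (\<lambda>d. f' (x + s *\<^sub>R u + h *\<^sub>R v) (d *\<^sub>R u))) (at s within {0..h})"
      by (rule has_derivative_compose[of "\<lambda>s. x + s *\<^sub>R u + h *\<^sub>R v" _ _ _ f])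
        (use inb[of s h] s h in \<open>auto intro!: derivative_eq_intros f\<close>)
    have 2: "((\<lambda>s. f (x + s *\<^sub>R u)) has_derivative (\<lambda>d. f' (x + s *\<^sub>R u) (d *\<^sub>R u))) (at s within {0..h})"
      by (rule has_derivative_compose[of "\<lambda>s. x + s *\<^sub>R u" _ _ _ f])
        (use inb[of s 0] s h in \<open>auto intro!: derivative_eq_intros f\<close>)
    show "(\<phi> has_derivative (\<lambda>d. f' (x + s *\<^sub>R u + h *\<^sub>R v) (d *\<^sub>R u) - f' (x + s *\<^sub>R u) (d *\<^sub>R u))) (at s within {0..h})"
      unfolding \<phi>_def using has_derivative_diff[OF 1 2] by simp
  qed (fact h)
  then obtain \<sigma> where \<sigma>: "0 < \<sigma>" "\<sigma> < h"
    and eq1: "\<phi> h - \<phi> 0 = f' (x + \<sigma> *\<^sub>R u + h *\<^sub>R v) (h *\<^sub>R u) - f' (x + \<sigma> *\<^sub>R u) (h *\<^sub>R u)" by auto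
  have lin: "f' y (h *\<^sub>R u) = h * f' y u" if "y \<in> ball x e" for y
    using f[OF that] by (simp add: has_derivative_def bounded_linear.linear linear_cmul)
  have eq1': "\<phi> h - \<phi> 0 = h * (f' (x + \<sigma> *\<^sub>R u + h *\<^sub>R v) u - f' (x + \<sigma> *\<^sub>R u) u)"
    unfolding eq1 using inb[of \<sigma> h] inb[of \<sigma> 0] \<sigma> h by (simp add: lin algebra_simps)
  define \<psi> where "\<psi> t = f' (x + \<sigma> *\<^sub>R u + t *\<^sub>R v) u" for t
  have "\<exists>\<tau>\<in>{0<..<h}. \<psi> h - \<psi> 0 = (\<lambda>d. f'' (x + \<sigma> *\<^sub>R u + \<tau> *\<^sub>R v) (d *\<^sub>R v)) (h - 0)"
  proof (rule mvt_simple)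
    fix t assume t: "0 \<le> t" "t \<le> h"
    show "(\<psi> has_derivative (\<lambda>d. f'' (x + \<sigma> *\<^sub>R u + t *\<^sub>R v) (d *\<^sub>R v))) (at t within {0..h})"
      unfolding \<psi>_def
      by (rule has_derivative_compose[of "\<lambda>t. x + \<sigma> *\<^sub>R u + t *\<^sub>R v" _ _ _ "\<lambda>z. f' z u"])
        (use t \<sigma> in \<open>auto intro!: derivative_eq_intros f' inb\<close>)
  qed (fact h)
  then obtain \<tau> where \<tau>: "0 < \<tau>" "\<tau> < h"
    and eq2: "\<psi> h - \<psi> 0 = f'' (x + \<sigma> *\<^sub>R u + \<tau> *\<^sub>R v) (h *\<^sub>R v)" by auto
  have y: "x + \<sigma> *\<^sub>R u + \<tau> *\<^sub>R v \<in> ball x e" using inb \<sigma> \<tau> by simp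
  have "f'' (x + \<sigma> *\<^sub>R u + \<tau> *\<^sub>R v) (h *\<^sub>R v) = h * f'' (x + \<sigma> *\<^sub>R u + \<tau> *\<^sub>R v) v"
    using f'[OF y] by (simp add: has_derivative_def bounded_linear.linear linear_cmul)
  then have "\<phi> h - \<phi> 0 = h * h * f'' (x + \<sigma> *\<^sub>R u + \<tau> *\<^sub>R v) v"
    using eq1' eq2 by (simp add: \<psi>_def)
  moreover have "\<phi> h - \<phi> 0 = f (x + h *\<^sub>R u + h *\<^sub>R v) - f (x + h *\<^sub>R u) - f (x + h *\<^sub>R v) + f x"
    by (simp add: \<phi>_def)
  ultimately show ?thesis using near[of \<sigma> \<tau>] \<sigma> \<tau> by (intro exI[of _ "x + \<sigma> *\<^sub>R u + \<tau> *\<^sub>R v"]) auto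
qed

text \<open>The second difference is symmetric in the two directions, so shrinking the parallelogram to \<open>x\<close>
  turns both mean value formulas into the same limit.\<close>

lemma symmetric_second_derivative_real:
  fixes f :: "'a::euclidean_space \<Rightarrow> real"
  assumes S: "open S" "smooth_on f S" "x \<in> S"
  shows "frechet_derivative (\<lambda>y. frechet_derivative f (at y) u) (at x) v
       = frechet_derivative (\<lambda>y. frechet_derivative f (at y) v) (at x) u"
proof -
  define D where "D a b y = frechet_derivative (\<lambda>y. frechet_derivative f (at y) a) (at y) b" for a b y
  obtain e where e: "e > 0" "ball x e \<subseteq> S" using S by (meson openE)
  have f: "(f has_derivative frechet_derivative f (at y)) (at y)" if "y \<in> ball x e" for y
    using smooth_on_has_derivative S(1,2) e(2) that by blast
  have f': "((\<lambda>y. frechet_derivative f (at y) w) has_derivative (\<lambda>v. D w v y)) (at y)"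
    if "y \<in> ball x e" for y w
    using smooth_on_has_derivative[OF S(1) smooth_on_frechet_derivative[OF S(2)]] e(2) that
    unfolding D_def by blast
  have cont: "isCont (D a b) x" for a b
    using S smooth_on_continuous_on[OF smooth_on_frechet_derivative[OF smooth_on_frechet_derivative[OF S(2)]]]
    by (simp add: continuous_on_eq_continuous_at D_def[abs_def])
  define k where "k = norm u + norm v + 1"
  have k: "0 < k" "norm u + norm v < k" by (simp_all add: k_def add_nonneg_pos)
  \<comment> \<open>Side lengths tending to 0 for which the parallelogram stays in the ball.\<close>
  define h where "h n = e / k * inverse (real (Suc n))" for n
  have h: "0 < h n" "h n * (norm u + norm v) < e" for n
  proof -
    show h_pos: "0 < h n" unfolding h_def using e k by simp
    have "h n * (norm u + norm v) < h n * k" using h_pos k by simp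
    also have "\<dots> = e * inverse (real (Suc n))" unfolding h_def using k(1) by simp
    also have "\<dots> \<le> e * 1" using e by (intro mult_left_mono) (simp_all add: field_simps)
    finally show "h n * (norm u + norm v) < e" by simp
  qed
  define r where "r n = h n * (norm u + norm v)" for n
  have r0: "r \<longlonglongrightarrow> 0"
  proof -
    have "(\<lambda>n. e / k * (norm u + norm v) * inverse (real (Suc n))) \<longlonglongrightarrow> e / k * (norm u + norm v) * 0"
      by (intro tendsto_intros LIMSEQ_inverse_real_of_nat)
    then show ?thesis by (simp add: r_def[abs_def] h_def mult_ac)
  qed
  have "\<exists>y z. dist x y \<le> r n \<and> dist x z \<le> r n \<and> D u v y = D v u z" for n
  proof -
    obtain y where y: "dist x y \<le> h n * (norm u + norm v)"
      "f (x + h n *\<^sub>R u + h n *\<^sub>R v) - f (x + h n *\<^sub>R u) - f (x + h n *\<^sub>R v) + f x = h n * h n * D u v y"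
      using second_difference_mean_value[where u = u and v = v and f'' = "\<lambda>y v. D u v y", OF f f' h[of n]] by blast
    have h': "h n * (norm v + norm u) < e" using h(2)[of n] by (simp add: add.commute)
    obtain z where z: "dist x z \<le> h n * (norm v + norm u)"
      "f (x + h n *\<^sub>R v + h n *\<^sub>R u) - f (x + h n *\<^sub>R v) - f (x + h n *\<^sub>R u) + f x = h n * h n * D v u z"
      using second_difference_mean_value[where u = v and v = u and f'' = "\<lambda>y u. D v u y", OF f f' h(1)[of n] h']
      by blast
    have "x + h n *\<^sub>R v + h n *\<^sub>R u = x + h n *\<^sub>R u + h n *\<^sub>R v" by simp
    with z(2) have "f (x + h n *\<^sub>R u + h n *\<^sub>R v) - f (x + h n *\<^sub>R v) - f (x + h n *\<^sub>R u) + f x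
        = h n * h n * D v u z" by simp
    with y(2) have "h n * h n * D u v y = h n * h n * D v u z" by linarith
    then have "D u v y = D v u z" using h(1)[of n] by simp
    moreover have "dist x y \<le> r n" "dist x z \<le> r n" using y(1) z(1) by (simp_all add: r_def add.commute)
    ultimately show ?thesis by blast
  qed
  then have "\<forall>n. \<exists>p. dist x (fst p) \<le> r n \<and> dist x (snd p) \<le> r n \<and> D u v (fst p) = D v u (snd p)"
    by simp
  from choice[OF this] obtain p where p: "\<And>n. dist x (fst (p n)) \<le> r n"
    "\<And>n. dist x (snd (p n)) \<le> r n" and eq: "\<And>n. D u v (fst (p n)) = D v u (snd (p n))"
    by blast
  have lim: "a \<longlonglongrightarrow> x" if "\<And>n. dist x (a n) \<le> r n" for a
    unfolding tendsto_dist_iff[of a]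
    by (rule tendsto_sandwich[OF _ _ tendsto_const r0]) (use that in \<open>simp_all add: dist_commute\<close>)
  have "(\<lambda>n. D u v (fst (p n))) \<longlonglongrightarrow> D u v x"
    by (rule isCont_tendsto_compose[OF cont lim[OF p(1)]])
  moreover have "(\<lambda>n. D v u (snd (p n))) \<longlonglongrightarrow> D v u x"
    by (rule isCont_tendsto_compose[OF cont lim[OF p(2)]])
  ultimately have "D u v x = D v u x" unfolding eq by (rule LIMSEQ_unique)
  then show ?thesis by (simp add: D_def)
qed

lemma frechet_derivative_bounded_linear:
  assumes "bounded_linear L" "f differentiable at x"
  shows "frechet_derivative (\<lambda>y. L (f y)) (at x) v = L (frechet_derivative f (at x) v)"
  using frechet_derivative_at[OF bounded_linear.has_derivative[OF assms(1) assms(2)[unfolded frechet_derivative_works]]]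
  by metis

section \<open>The Hopf frame\<close>

text \<open>In complex coordinates these are \<open>(z\<^sub>1, z\<^sub>2) \<mapsto> (\<i> z\<^sub>1, \<i> z\<^sub>2)\<close>, which is \<open>Y2\<close>,
  the map \<open>(- cnj z\<^sub>2, cnj z\<^sub>1)\<close> and the composition \<open>(\<i> cnj z\<^sub>2, - \<i> cnj z\<^sub>1)\<close> of the
  first followed by the second. They are left multiplications by imaginary quaternions in suitable
  coordinates, so at each point of \<open>S3\<close> they form an orthonormal basis of the tangent space, and each
  of them is a Killing field. The index type \<open>3\<close> is used for its arithmetic modulo 3, which writes
  cyclic formulas uniformly.\<close>

definition hopf_frame :: "3 \<Rightarrow> real^4 \<Rightarrow> real^4" where
  "hopf_frame a x =
     (if a = 1 then Y2 x
      else if a = 2 then vector [- (x $ 3), x $ 4, x $ 1, - (x $ 2)]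
      else vector [x $ 4, x $ 3, - (x $ 2), - (x $ 1)])"

lemma cyclic_index:
  "(1::3) + 1 = 2" "(2::3) + 1 = 3" "(3::3) + 1 = 1" "(1::3) + 2 = 3" "(2::3) + 2 = 1" "(3::3) + 2 = 2" "(4::3) = 1" "(5::3) = 2"
  "(1::3) \<noteq> 2" "(2::3) \<noteq> 1" "(2::3) \<noteq> 3" "(3::3) \<noteq> 2" "(1::3) \<noteq> 3" "(3::3) \<noteq> 1"
  by simp_all

lemma hopf_frame_nth:
  "hopf_frame 1 x $ 1 = - (x $ 2)" "hopf_frame 1 x $ 2 = x $ 1"
  "hopf_frame 1 x $ 3 = - (x $ 4)" "hopf_frame 1 x $ 4 = x $ 3"
  "hopf_frame 2 x $ 1 = - (x $ 3)" "hopf_frame 2 x $ 2 = x $ 4"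
  "hopf_frame 2 x $ 3 = x $ 1" "hopf_frame 2 x $ 4 = - (x $ 2)"
  "hopf_frame 3 x $ 1 = x $ 4" "hopf_frame 3 x $ 2 = x $ 3"
  "hopf_frame 3 x $ 3 = - (x $ 2)" "hopf_frame 3 x $ 4 = - (x $ 1)"
  unfolding hopf_frame_def by (simp_all add: Y2_nth vector_def cyclic_index del: one_add_one)

lemma hopf_frame_1: "hopf_frame 1 = Y2"
  by (simp add: hopf_frame_def fun_eq_iff)

lemma bounded_linear_hopf_frame: "bounded_linear (hopf_frame a)"
proof -
  have "linear (hopf_frame a)"
    using exhaust_3[of a]
    by (auto intro!: linearI simp: vec_eq_iff forall_4 hopf_frame_nth algebra_simps)
  then show ?thesis by (simp add: linear_conv_bounded_linear)
qed

lemmas hopf_frame_linear = bounded_linear.linear[OF bounded_linear_hopf_frame]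

lemma hopf_frame_skew: "hopf_frame a u \<bullet> v = - (u \<bullet> hopf_frame a v)"
  using exhaust_3[of a] by (auto simp: inner_vec_def sum_4 hopf_frame_nth algebra_simps)

lemma hopf_frame_orthogonal [simp]: "hopf_frame a x \<bullet> x = 0" "x \<bullet> hopf_frame a x = 0"
  using hopf_frame_skew[of a x x] by (auto simp: inner_commute)

lemma hopf_frame_orthonormal: "hopf_frame a x \<bullet> hopf_frame b x = (if a = b then x \<bullet> x else 0)"
  using exhaust_3[of a] exhaust_3[of b]
  by (elim disjE) (simp_all add: inner_vec_def sum_4 hopf_frame_nth algebra_simps)

lemma hopf_frame_tangent [simp]: "hopf_frame a x \<in> tangent_space x"
  by (simp add: tangent_space_def)

text \<open>Up to sign the three fields multiply like the quaternion units.\<close>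

lemma hopf_frame_compose:
  "hopf_frame a (hopf_frame a x) = - x"
  "hopf_frame (a + 1) (hopf_frame a x) = hopf_frame (a + 2) x"
  "hopf_frame a (hopf_frame (a + 1) x) = - hopf_frame (a + 2) x"
proof -
  have "hopf_frame a (hopf_frame a x) = - x \<and> hopf_frame (a + 1) (hopf_frame a x) = hopf_frame (a + 2) x
    \<and> hopf_frame a (hopf_frame (a + 1) x) = - hopf_frame (a + 2) x"
    using exhaust_3[of a]
    by (elim disjE) (simp_all add: vec_eq_iff forall_4 cyclic_index hopf_frame_nth del: one_add_one)
  then show "hopf_frame a (hopf_frame a x) = - x"
    "hopf_frame (a + 1) (hopf_frame a x) = hopf_frame (a + 2) x"
    "hopf_frame a (hopf_frame (a + 1) x) = - hopf_frame (a + 2) x" by blast+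
qed

text \<open>For \<open>x \<noteq> 0\<close> the vectors \<open>x\<close> and \<open>hopf_frame a x\<close> are an orthogonal basis of four-space, all of the
  same length.\<close>

lemma hopf_frame_expansion:
  "(\<Sum>a\<in>UNIV. (v \<bullet> hopf_frame a x) *\<^sub>R hopf_frame a x) + (v \<bullet> x) *\<^sub>R x = (x \<bullet> x) *\<^sub>R v"
  by (simp add: vec_eq_iff forall_4 sum_3 inner_vec_def sum_4 hopf_frame_nth algebra_simps)

lemma tangent_expansion:
  assumes "x \<in> S3" "v \<in> tangent_space x"
  shows "v = (\<Sum>a\<in>UNIV. (v \<bullet> hopf_frame a x) *\<^sub>R hopf_frame a x)"
  using hopf_frame_expansion[of v x] assms by (simp add: tangent_space_def norm_eq_1)

section \<open>Functions on the sphere and their derivatives along the frame\<close>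

text \<open>A function on \<open>S3\<close> is represented by its extension constant along rays.\<close>

definition radial_smooth :: "(real^4 \<Rightarrow> complex) \<Rightarrow> bool" where
  "radial_smooth f \<longleftrightarrow> smooth_on f (- {0}) \<and> (\<forall>y. f (sgn y) = f y)"

definition frame_deriv :: "3 \<Rightarrow> (real^4 \<Rightarrow> complex) \<Rightarrow> real^4 \<Rightarrow> complex" where
  "frame_deriv a f x = frechet_derivative f (at x) (hopf_frame a x)"

lemma open_punctured [simp]: "open (- {0::real^4})"
  by auto

lemma S3_nonzero: "x \<in> S3 \<Longrightarrow> x \<noteq> 0"
  by auto

lemma S3_sgn [simp]: "x \<in> S3 \<Longrightarrow> sgn x = x"
  by (simp add: sgn_div_norm)

lemma sgn_S3 [simp]: "y \<noteq> 0 \<Longrightarrow> sgn y \<in> S3"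
  by (simp add: norm_sgn)

lemma radial_smoothD: "radial_smooth f \<Longrightarrow> f (sgn y) = f y"
  by (simp add: radial_smooth_def)

lemma radial_smooth_has_derivative:
  "radial_smooth f \<Longrightarrow> x \<noteq> 0 \<Longrightarrow> (f has_derivative frechet_derivative f (at x)) (at x)"
  unfolding radial_smooth_def by (auto intro: smooth_on_has_derivative)

lemma radial_smooth_continuous_on: "radial_smooth f \<Longrightarrow> continuous_on S3 f"
  unfolding radial_smooth_def
  by (auto intro: continuous_on_subset[OF smooth_on_continuous_on])

lemma radial_smooth_const [simp]: "radial_smooth (\<lambda>x. c)"
  by (simp add: radial_smooth_def smooth_on_const)

lemma radial_smooth_add: "radial_smooth f \<Longrightarrow> radial_smooth g \<Longrightarrow> radial_smooth (\<lambda>x. f x + g x)"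
  by (simp add: radial_smooth_def smooth_on_add)

lemma radial_smooth_mult: "radial_smooth f \<Longrightarrow> radial_smooth g \<Longrightarrow> radial_smooth (\<lambda>x. f x * g x)"
  by (simp add: radial_smooth_def smooth_on_bounded_bilinear[OF bounded_bilinear_mult])

lemma radial_smooth_minus: "radial_smooth f \<Longrightarrow> radial_smooth (\<lambda>x. - f x)"
  by (simp add: radial_smooth_def smooth_on_bounded_linear[OF bounded_linear_minus[OF bounded_linear_ident]])

lemma radial_smooth_diff: "radial_smooth f \<Longrightarrow> radial_smooth g \<Longrightarrow> radial_smooth (\<lambda>x. f x - g x)"
  using radial_smooth_add[OF _ radial_smooth_minus, of f g] by simp

lemma radial_smooth_cnj: "radial_smooth f \<Longrightarrow> radial_smooth (\<lambda>x. cnj (f x))"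
  by (simp add: radial_smooth_def smooth_on_bounded_linear[OF bounded_linear_cnj])

lemma radial_smooth_sum:
  "(\<And>i. i \<in> I \<Longrightarrow> radial_smooth (f i)) \<Longrightarrow> radial_smooth (\<lambda>x. \<Sum>i\<in>I. f i x)"
  by (induction I rule: infinite_finite_induct) (auto intro: radial_smooth_add)

lemma frechet_derivative_vec_expansion:
  assumes "f differentiable at x"
  shows "frechet_derivative f (at x) v = (\<Sum>e\<in>Basis. (v \<bullet> e) *\<^sub>R frechet_derivative f (at x) e)"
proof -
  have l: "linear (frechet_derivative f (at x))" by (rule linear_frechet_derivative[OF assms])
  have "frechet_derivative f (at x) v = frechet_derivative f (at x) (\<Sum>e\<in>Basis. (v \<bullet> e) *\<^sub>R e)"
    by (simp add: euclidean_representation)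
  then show ?thesis by (simp add: linear_sum[OF l] linear_cmul[OF l])
qed

lemma radial_smooth_frame_deriv:
  assumes f: "radial_smooth f"
  shows "radial_smooth (frame_deriv a f)"
proof -
  have sm: "smooth_on f (- {0})" using f by (simp add: radial_smooth_def)
  have "smooth_on (\<lambda>x. \<Sum>e\<in>Basis. (hopf_frame a x \<bullet> e) *\<^sub>R frechet_derivative f (at x) e) (- {0})"
    by (intro smooth_on_sum smooth_on_bounded_bilinear[OF bounded_bilinear_scaleR]
        smooth_on_frechet_derivative sm smooth_on_linear open_punctured
        bounded_linear_compose[OF bounded_linear_inner_left bounded_linear_hopf_frame, unfolded o_def])
  then have 1: "smooth_on (frame_deriv a f) (- {0})"
  proof (rule smooth_on_cong[rotated])
    fix x :: "real^4" assume "x \<in> - {0}"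
    then have "f differentiable at x"
      using radial_smooth_has_derivative[OF f] differentiable_def by auto
    then show "(\<Sum>e\<in>Basis. (hopf_frame a x \<bullet> e) *\<^sub>R frechet_derivative f (at x) e) = frame_deriv a f x"
      by (metis frame_deriv_def frechet_derivative_vec_expansion)
  qed simp
  have "frame_deriv a f (sgn y) = frame_deriv a f y" for y
  proof (cases "y = 0")
    case False
    let ?c = "inverse (norm y)"
    have s: "sgn y = ?c *\<^sub>R y" by (simp add: sgn_div_norm)
    have "((\<lambda>z. f (?c *\<^sub>R z)) has_derivative (\<lambda>v. frechet_derivative f (at (?c *\<^sub>R y)) (?c *\<^sub>R v))) (at y)"
      by (rule has_derivative_compose[of "\<lambda>z. ?c *\<^sub>R z" _ _ _ f])
        (use False in \<open>auto intro!: derivative_eq_intros radial_smooth_has_derivative[OF f]\<close>)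
    moreover have "f (?c *\<^sub>R z) = f z" for z
      using f[THEN radial_smoothD, of "?c *\<^sub>R z"] f[THEN radial_smoothD, of z] False
      by (simp add: sgn_scaleR)
    ultimately have "(f has_derivative (\<lambda>v. frechet_derivative f (at (sgn y)) (?c *\<^sub>R v))) (at y)"
      by (simp add: s)
    then have "frechet_derivative f (at y) = (\<lambda>v. frechet_derivative f (at (sgn y)) (?c *\<^sub>R v))"
      using frechet_derivative_at by metis
    then show ?thesis
      by (simp add: frame_deriv_def s linear_cmul[OF hopf_frame_linear])
  qed simp
  with 1 show ?thesis by (simp add: radial_smooth_def)
qed

lemma frame_derivI:
  "(f has_derivative f') (at x) \<Longrightarrow> frame_deriv a f x = f' (hopf_frame a x)"
  using frechet_derivative_at frame_deriv_def by metis

lemma frame_deriv_const [simp]: "frame_deriv a (\<lambda>x. c) x = 0"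
  by (rule frame_derivI[THEN trans]) (rule has_derivative_const, simp)

lemma frame_deriv_add:
  assumes "radial_smooth f" "radial_smooth g" "x \<in> S3"
  shows "frame_deriv a (\<lambda>y. f y + g y) x = frame_deriv a f x + frame_deriv a g x"
  by (rule frame_derivI[THEN trans], rule has_derivative_add[OF assms(1,2)[THEN radial_smooth_has_derivative]])
    (use assms S3_nonzero in \<open>auto simp: frame_deriv_def\<close>)

lemma frame_deriv_minus:
  assumes "radial_smooth f" "x \<in> S3"
  shows "frame_deriv a (\<lambda>y. - f y) x = - frame_deriv a f x"
  by (rule frame_derivI[THEN trans], rule has_derivative_minus[OF assms(1)[THEN radial_smooth_has_derivative]])
    (use assms S3_nonzero in \<open>auto simp: frame_deriv_def\<close>)

lemma frame_deriv_diff: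
  assumes "radial_smooth f" "radial_smooth g" "x \<in> S3"
  shows "frame_deriv a (\<lambda>y. f y - g y) x = frame_deriv a f x - frame_deriv a g x"
  by (rule frame_derivI[THEN trans], rule has_derivative_diff[OF assms(1,2)[THEN radial_smooth_has_derivative]])
    (use assms S3_nonzero in \<open>auto simp: frame_deriv_def\<close>)

lemma frame_deriv_mult:
  assumes "radial_smooth f" "radial_smooth g" "x \<in> S3"
  shows "frame_deriv a (\<lambda>y. f y * g y) x = f x * frame_deriv a g x + frame_deriv a f x * g x"
  by (rule frame_derivI[THEN trans], rule has_derivative_mult[OF assms(1,2)[THEN radial_smooth_has_derivative]])
    (use assms S3_nonzero in \<open>auto simp: frame_deriv_def\<close>)

lemma frame_deriv_cmult:
  assumes "radial_smooth f" "x \<in> S3"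
  shows "frame_deriv a (\<lambda>y. c * f y) x = c * frame_deriv a f x"
  using frame_deriv_mult[OF radial_smooth_const assms, of a c] by simp

lemma frame_deriv_cnj:
  assumes "radial_smooth f" "x \<in> S3"
  shows "frame_deriv a (\<lambda>y. cnj (f y)) x = cnj (frame_deriv a f x)"
  by (rule frame_derivI[THEN trans],
      rule bounded_linear.has_derivative[OF bounded_linear_cnj assms(1)[THEN radial_smooth_has_derivative]])
    (use assms S3_nonzero in \<open>auto simp: frame_deriv_def\<close>)

lemma frame_deriv_cong:
  assumes f: "radial_smooth f" and x: "x \<in> S3" and eq: "\<And>y. y \<in> S3 \<Longrightarrow> f y = g y" and "radial_smooth g"
  shows "frame_deriv a f x = frame_deriv a g x"
proof -
  have "f y = g y" if "y \<in> - {0}" for y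
    using that eq[OF sgn_S3[of y]] assms(1,4)[THEN radial_smoothD, of y] by simp
  then have "frechet_derivative f (at x) = frechet_derivative g (at x)"
    using radial_smooth_has_derivative[OF f S3_nonzero[OF x]] x
    by (intro frechet_derivative_transform_within_open[where X = "- {0}"])
      (auto simp: differentiable_def)
  then show ?thesis by (simp add: frame_deriv_def)
qed

text \<open>Apply the real case to the real and the imaginary part.\<close>

lemma symmetric_second_derivative:
  fixes f :: "'a::euclidean_space \<Rightarrow> complex"
  assumes S: "open S" "smooth_on f S" "x \<in> S"
  shows "frechet_derivative (\<lambda>y. frechet_derivative f (at y) u) (at x) v
       = frechet_derivative (\<lambda>y. frechet_derivative f (at y) v) (at x) u"
proof -
  have d: "f differentiable at y" if "y \<in> S" for y
    using smooth_on_has_derivative[OF S(1,2) that] differentiable_def by auto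
  have d2: "(\<lambda>y. frechet_derivative f (at y) w) differentiable at x" for w
    using smooth_on_has_derivative[OF S(1) smooth_on_frechet_derivative[OF S(2)] S(3)] differentiable_def by blast
  have *: "L (frechet_derivative (\<lambda>y. frechet_derivative f (at y) u) (at x) v)
         = L (frechet_derivative (\<lambda>y. frechet_derivative f (at y) v) (at x) u)"
    if L: "bounded_linear L" for L :: "complex \<Rightarrow> real"
  proof -
    have "frechet_derivative (\<lambda>y. frechet_derivative (\<lambda>z. L (f z)) (at y) a) (at x) b
        = L (frechet_derivative (\<lambda>y. frechet_derivative f (at y) a) (at x) b)" for a b
    proof -
      have "frechet_derivative (\<lambda>y. L (frechet_derivative f (at y) a)) (at x)
          = frechet_derivative (\<lambda>y. frechet_derivative (\<lambda>z. L (f z)) (at y) a) (at x)"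
        by (rule frechet_derivative_transform_within_open[OF _ S(1) S(3)])
          (use differentiableI[OF bounded_linear.has_derivative[OF L d2[unfolded frechet_derivative_works]]] frechet_derivative_bounded_linear[OF L d] in auto)
      then show ?thesis using frechet_derivative_bounded_linear[OF L d2] by metis
    qed
    then show ?thesis
      using symmetric_second_derivative_real[OF S(1) smooth_on_bounded_linear[OF L S(1,2)] S(3), of u v] by simp
  qed
  show ?thesis
    using *[OF bounded_linear_Re] *[OF bounded_linear_Im] by (rule complex_eqI)
qed

text \<open>The field \<open>hopf_frame b\<close> is linear, hence its own derivative, which gives the last term.\<close>

lemma frame_deriv_frame_deriv:
  assumes f: "radial_smooth f" and x: "x \<in> S3"
  shows "frame_deriv a (frame_deriv b f) x
    = (\<Sum>e\<in>Basis. \<Sum>e'\<in>Basis. ((hopf_frame b x \<bullet> e) * (hopf_frame a x \<bullet> e')) *\<^sub>R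
           frechet_derivative (\<lambda>y. frechet_derivative f (at y) e) (at x) e')
      + frechet_derivative f (at x) (hopf_frame b (hopf_frame a x))"
proof -
  have x0: "x \<in> - {0}" using x by auto
  have sm: "smooth_on f (- {0})" using f by (simp add: radial_smooth_def)
  have d: "f differentiable at y" if "y \<in> - {0}" for y
    using smooth_on_has_derivative[OF _ sm that] differentiable_def by auto
  have d2: "((\<lambda>y. frechet_derivative f (at y) e) has_derivative
      frechet_derivative (\<lambda>y. frechet_derivative f (at y) e) (at x)) (at x)" for e
    using smooth_on_has_derivative[OF _ smooth_on_frechet_derivative[OF sm] x0] by simp
  have hb: "((\<lambda>y. hopf_frame b y \<bullet> e) has_derivative (\<lambda>v. hopf_frame b v \<bullet> e)) (at x)" for e
    by (intro bounded_linear.has_derivative[OF bounded_linear_inner_left]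
        bounded_linear.has_derivative[OF bounded_linear_hopf_frame] has_derivative_ident)
  let ?g = "\<lambda>y. \<Sum>e\<in>Basis. (hopf_frame b y \<bullet> e) *\<^sub>R frechet_derivative f (at y) e"
  have "(?g has_derivative (\<lambda>v. \<Sum>e\<in>Basis.
      (hopf_frame b x \<bullet> e) *\<^sub>R frechet_derivative (\<lambda>y. frechet_derivative f (at y) e) (at x) v
      + (hopf_frame b v \<bullet> e) *\<^sub>R frechet_derivative f (at x) e)) (at x)"
    by (intro has_derivative_sum has_derivative_scaleR hb d2)
  moreover have "?g y = frame_deriv b f y" if "y \<in> - {0}" for y
    using frechet_derivative_vec_expansion[OF d[OF that], of "hopf_frame b y"] by (simp add: frame_deriv_def)
  ultimately have "(frame_deriv b f has_derivative (\<lambda>v. \<Sum>e\<in>Basis.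
      (hopf_frame b x \<bullet> e) *\<^sub>R frechet_derivative (\<lambda>y. frechet_derivative f (at y) e) (at x) v
      + (hopf_frame b v \<bullet> e) *\<^sub>R frechet_derivative f (at x) e)) (at x)"
    using has_derivative_transform_within_open[OF _ open_punctured x0] by blast
  from frame_derivI[OF this, of a] show ?thesis
    using frechet_derivative_vec_expansion[OF d[OF x0], of "hopf_frame b (hopf_frame a x)"]
      frechet_derivative_vec_expansion[of "\<lambda>y. frechet_derivative f (at y) _" x "hopf_frame a x",
        OF differentiableI[OF d2]]
    by (simp add: sum.distrib scaleR_sum_right)
qed

text \<open>The second-order parts cancel, so only the matrix commutator of the two linear fields is left.\<close>

lemma frame_deriv_commute:
  assumes f: "radial_smooth f" and x: "x \<in> S3"
  shows "frame_deriv a (frame_deriv (a + 1) f) x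
       = frame_deriv (a + 1) (frame_deriv a f) x + 2 * frame_deriv (a + 2) f x"
proof -
  have x0: "x \<in> - {0}" using x by auto
  have sm: "smooth_on f (- {0})" using f by (simp add: radial_smooth_def)
  have lin: "linear (frechet_derivative f (at x))"
    using radial_smooth_has_derivative[OF f S3_nonzero[OF x]] by (rule has_derivative_linear)
  have "(\<Sum>e\<in>Basis. \<Sum>e'\<in>Basis. ((hopf_frame b x \<bullet> e) * (hopf_frame c x \<bullet> e')) *\<^sub>R
           frechet_derivative (\<lambda>y. frechet_derivative f (at y) e) (at x) e')
      = (\<Sum>e\<in>Basis. \<Sum>e'\<in>Basis. ((hopf_frame c x \<bullet> e) * (hopf_frame b x \<bullet> e')) *\<^sub>R
           frechet_derivative (\<lambda>y. frechet_derivative f (at y) e) (at x) e')" for b c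
    by (subst sum.swap)
      (simp add: symmetric_second_derivative[OF open_punctured sm x0] mult.commute)
  from this[of "a + 1" a] show ?thesis
    by (simp add: frame_deriv_frame_deriv[OF f x] hopf_frame_compose linear_neg[OF lin])
      (simp add: frame_deriv_def)
qed

text \<open>The restriction of a linear \<open>l\<close> to \<open>S3\<close>, made constant along rays. Frame vectors are linear in
  the base point and orthogonal to it, so differentiating along \<open>hopf_frame a\<close> gives the restriction
  of another linear function, \<open>l \<circ> hopf_frame a\<close>.\<close>

definition linear_on_sphere :: "(real^4 \<Rightarrow> complex) \<Rightarrow> real^4 \<Rightarrow> complex" where
  "linear_on_sphere l x = inverse (norm x) *\<^sub>R l x"

lemma linear_on_sphere_S3 [simp]: "x \<in> S3 \<Longrightarrow> linear_on_sphere l x = l x"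
  by (simp add: linear_on_sphere_def)

lemma radial_smooth_linear_on_sphere:
  assumes "bounded_linear l"
  shows "radial_smooth (linear_on_sphere l)"
proof -
  have "smooth_on (\<lambda>x. inverse (norm x) *\<^sub>R l x) (- {0})"
    by (intro smooth_on_bounded_bilinear[OF bounded_bilinear_scaleR] smooth_on_inverse_norm
        smooth_on_linear assms open_punctured)
  moreover have "linear_on_sphere l (sgn y) = linear_on_sphere l y" for y
    using linear_cmul[OF bounded_linear.linear[OF assms]] linear_0[OF bounded_linear.linear[OF assms]]
    by (cases "y = 0") (simp_all add: linear_on_sphere_def sgn_div_norm)
  ultimately show ?thesis
    by (simp add: radial_smooth_def linear_on_sphere_def[abs_def])
qed

lemma frame_deriv_linear_on_sphere:
  assumes "bounded_linear l" and x: "x \<in> S3"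
  shows "frame_deriv a (linear_on_sphere l) x = l (hopf_frame a x)"
proof -
  have "((\<lambda>x. inverse (norm x)) has_derivative (\<lambda>v. - (v \<bullet> x))) (at x)"
    using has_derivative_inverse_norm[OF S3_nonzero[OF x]] x by (simp add: inner_commute)
  from has_derivative_scaleR[OF this bounded_linear.has_derivative[OF assms(1) has_derivative_ident]]
  have "((\<lambda>x. inverse (norm x) *\<^sub>R l x) has_derivative
      (\<lambda>v. inverse (norm x) *\<^sub>R l v + (- (v \<bullet> x)) *\<^sub>R l x)) (at x)" .
  from frame_derivI[OF this, of a] x show ?thesis
    by (simp add: linear_on_sphere_def[abs_def])
qed

section \<open>Integration over the sphere\<close>

text \<open>It suffices to compare the two measures on boxes, where the image under the inverse transformation
  has the same measure.\<close>

lemma distr_orthogonal_transformation: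
  fixes R :: "real^'n::{finite,wellorder} \<Rightarrow> real^'n::_"
  assumes R: "orthogonal_transformation R"
  shows "distr lborel borel R = lborel"
proof (rule lborel_eqI[symmetric])
  fix l u :: "real^'n::_"
  assume lu: "\<And>b. b \<in> Basis \<Longrightarrow> l \<bullet> b \<le> u \<bullet> b"
  let ?Q = "inv R"
  have Q: "orthogonal_transformation ?Q" by (rule orthogonal_transformation_inv[OF R])
  have meas: "R \<in> borel_measurable borel"
    by (intro borel_measurable_continuous_onI linear_continuous_on)
      (simp add: linear_conv_bounded_linear[symmetric] orthogonal_transformation_linear[OF R])
  have pre: "R -` box l u = ?Q ` box l u"
    using bij_vimage_eq_inv_image[OF orthogonal_transformation_bij[OF R]] by simp
  have b: "box l u \<in> lmeasurable" by simp
  have "R -` box l u \<in> sets borel" using measurable_sets[OF meas, of "box l u"] by simp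
  then have "emeasure (distr lborel borel R) (box l u) = emeasure lebesgue (?Q ` box l u)"
    by (simp add: emeasure_distr meas pre)
  also have "\<dots> = ennreal (measure lebesgue (?Q ` box l u))"
    by (rule emeasure_eq_measure2) (use measurable_orthogonal_image[OF Q b] in auto)
  also have "\<dots> = ennreal (measure lebesgue (box l u))"
    by (simp add: measure_orthogonal_image[OF Q b])
  also have "\<dots> = emeasure lborel (box l u)"
    by (simp add: emeasure_eq_measure2[symmetric] lmeasurable_iff_integrable emeasure_lborel_box lu)
  also have "\<dots> = ennreal (\<Prod>b\<in>Basis. (u - l) \<bullet> b)" using lu by (simp add: emeasure_lborel_box)
  finally show "emeasure (distr lborel borel R) (box l u) = ennreal (\<Prod>b\<in>Basis. (u - l) \<bullet> b)" .
qed simp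

lemma AE_nonzero: "AE x::real^4 in lborel. x \<noteq> 0"
  by (rule AE_lborel_singleton)

lemma borel_measurable_sgn_compose:
  assumes "continuous_on S3 (f :: real^4 \<Rightarrow> 'b::topological_space)"
  shows "(\<lambda>x. f (sgn x)) \<in> borel_measurable borel"
proof (rule borel_measurable_continuous_countable_exceptions[where X = "{0}"])
  have "continuous_on (- {0::real^4}) sgn" by (intro continuous_intros) auto
  then show "continuous_on (- {0}) (\<lambda>x. f (sgn x))"
    by (rule continuous_on_compose2[OF assms]) (use sgn_S3 in blast)
qed simp

lemma borel_measurable_ball_sgn_compose:
  assumes "continuous_on S3 (f :: real^4 \<Rightarrow> 'b::{real_normed_vector, second_countable_topology})"
  shows "(\<lambda>x. indicat_real (ball 0 1) x *\<^sub>R f (sgn x)) \<in> borel_measurable borel"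
  using borel_measurable_sgn_compose[OF assms]
  by (intro borel_measurable_scaleR borel_measurable_indicator) auto

lemma integrable_sphere:
  fixes f :: "real^4 \<Rightarrow> 'b::{banach, second_countable_topology}"
  assumes "continuous_on S3 f"
  shows "set_integrable lborel (ball 0 1) (\<lambda>x. f (sgn x))"
proof -
  have "compact (f ` S3)" by (rule compact_continuous_image[OF assms compact_sphere])
  then obtain K where K: "\<And>x. x \<in> S3 \<Longrightarrow> norm (f x) \<le> K"
    by (metis bounded_iff compact_imp_bounded imageI)
  show ?thesis
    unfolding set_integrable_def
  proof (rule integrableI_bounded_set[where A = "ball 0 1" and B = K])
    show "(\<lambda>x. indicat_real (ball 0 1) x *\<^sub>R f (sgn x)) \<in> borel_measurable lborel"
      using borel_measurable_ball_sgn_compose[OF assms] by simp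
    show "emeasure lborel (ball (0::real^4) 1) < \<infinity>"
      by (rule emeasure_lborel_ball_finite)
    show "AE x in lborel. x \<in> ball 0 1 \<longrightarrow> norm (indicat_real (ball 0 1) x *\<^sub>R f (sgn x)) \<le> K"
      using AE_nonzero by eventually_elim (auto intro!: K simp: norm_sgn)
  qed auto
qed

lemma sphere_integral_cong:
  assumes "\<And>x. x \<in> S3 \<Longrightarrow> f x = g x" "continuous_on S3 f"
  shows "sphere_integral f = sphere_integral g"
proof -
  have g: "continuous_on S3 g" using assms by (metis continuous_on_cong)
  have "(LINT x:ball 0 1|lborel. f (sgn x)) = (LINT x:ball 0 1|lborel. g (sgn x))"
    unfolding set_lebesgue_integral_def
  proof (intro integral_cong_AE)
    show "AE x in lborel. indicat_real (ball 0 1) x *\<^sub>R f (sgn x) = indicat_real (ball 0 1) x *\<^sub>R g (sgn x)"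
      using AE_nonzero by eventually_elim (simp add: assms(1)[OF sgn_S3])
  qed (simp_all add: borel_measurable_ball_sgn_compose[OF assms(2)] borel_measurable_ball_sgn_compose[OF g])
  then show ?thesis by (simp add: sphere_integral_def)
qed

lemma sphere_integral_add:
  assumes "continuous_on S3 f" "continuous_on S3 g"
  shows "sphere_integral (\<lambda>x. f x + g x) = sphere_integral f + sphere_integral g"
  by (simp add: sphere_integral_def set_integral_add(2)[OF assms[THEN integrable_sphere]] algebra_simps)

lemma sphere_integral_cmult:
  "sphere_integral (\<lambda>x. c * f x) = c * sphere_integral f"
  by (simp add: sphere_integral_def)

lemma sphere_integral_of_real:
  "sphere_integral (\<lambda>x. of_real (f x)) = of_real (4 * (LINT x:ball 0 1|lborel. f (sgn x)))"
  by (simp add: sphere_integral_def set_integral_complex_of_real)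

lemma sphere_integral_of_real_nonneg:
  assumes "\<And>x. x \<in> S3 \<Longrightarrow> 0 \<le> f x"
  shows "0 \<le> Re (sphere_integral (\<lambda>x. of_real (f x)))"
proof -
  have "AE x in lborel. 0 \<le> indicat_real (ball 0 1) x *\<^sub>R f (sgn x)"
    using AE_nonzero by eventually_elim (simp add: assms[OF sgn_S3])
  then have "0 \<le> (LINT x:ball 0 1|lborel. f (sgn x))"
    unfolding set_lebesgue_integral_def by (rule integral_nonneg_AE)
  then show ?thesis by (simp add: sphere_integral_of_real)
qed

text \<open>A continuous nonnegative integrand that is positive somewhere on the sphere is positive on a
  nonempty open subset of the ball, and this set is not negligible.\<close>

lemma sphere_integral_of_real_eq_0:
  assumes nn: "\<And>x. x \<in> S3 \<Longrightarrow> 0 \<le> f x" and f: "continuous_on S3 f"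
    and 0: "sphere_integral (\<lambda>x. of_real (f x)) = 0" and x: "x \<in> S3"
  shows "f x = 0"
proof (rule ccontr)
  assume ne: "f x \<noteq> 0"
  let ?g = "\<lambda>x. indicat_real (ball 0 1) x *\<^sub>R f (sgn x)"
  have "AE x in lborel. 0 \<le> ?g x"
    using AE_nonzero by eventually_elim (simp add: nn[OF sgn_S3])
  moreover have "integral\<^sup>L lborel ?g = 0"
    using 0 unfolding sphere_integral_of_real set_lebesgue_integral_def by simp
  ultimately have "AE x in lborel. ?g x = 0"
    using integral_nonneg_eq_0_iff_AE integrable_sphere[OF f, unfolded set_integrable_def] by blast
  then have AE: "AE y in lborel. \<not> (y \<in> ball 0 1 - {0} \<and> f (sgn y) \<noteq> 0)"
    by eventually_elim auto
  have "continuous_on (ball 0 1 - {0::real^4}) sgn" by (intro continuous_intros) auto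
  then have "continuous_on (ball 0 1 - {0::real^4}) (\<lambda>x. f (sgn x))"
    by (rule continuous_on_compose2[OF f]) (use sgn_S3 in blast)
  then have "open ((\<lambda>x. f (sgn x)) -` (- {0}) \<inter> (ball 0 1 - {0}))"
    by (subst Int_commute) (rule continuous_open_preimage, auto)
  moreover have "(\<lambda>x. f (sgn x)) -` (- {0}) \<inter> (ball 0 1 - {0}) = {y. y \<in> ball 0 1 - {0} \<and> f (sgn y) \<noteq> 0}"
    by auto
  ultimately have op: "open {y. y \<in> ball 0 1 - {0::real^4} \<and> f (sgn y) \<noteq> 0}" by simp
  have "{y. y \<in> ball 0 1 - {0::real^4} \<and> f (sgn y) \<noteq> 0} \<noteq> {}"
  proof -
    \<comment> \<open>Halving \<open>x\<close> moves it into the open ball.\<close>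
    have "x /\<^sub>R 2 \<in> {y. y \<in> ball 0 1 - {0::real^4} \<and> f (sgn y) \<noteq> 0}"
      using x ne S3_nonzero[OF x] by (simp add: sgn_scaleR)
    then show ?thesis by blast
  qed
  moreover have "negligible {y. y \<in> ball 0 1 - {0::real^4} \<and> f (sgn y) \<noteq> 0}" (is "negligible ?N")
  proof -
    have "?N \<in> null_sets lborel"
      using AE_iff_null[of lborel "\<lambda>y. \<not> (y \<in> ball 0 1 - {0} \<and> f (sgn y) \<noteq> 0)"] AE op by simp
    then show ?thesis by (simp add: negligible_iff_null_sets null_sets_completionI)
  qed
  ultimately show False using open_not_negligible[OF op] by blast
qed

lemma sphere_integral_orthogonal:
  assumes R: "orthogonal_transformation R" and f: "continuous_on S3 f"
  shows "sphere_integral (\<lambda>x. f (R x)) = sphere_integral f"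
proof -
  have lin: "linear R" by (rule orthogonal_transformation_linear[OF R])
  have nR: "norm (R x) = norm x" for x by (rule orthogonal_transformation_norm[OF R])
  have s: "sgn (R x) = R (sgn x)" for x
    by (simp add: sgn_div_norm nR linear_cmul[OF lin])
  have meas: "R \<in> borel_measurable lborel"
    using lin by (simp add: borel_measurable_continuous_onI linear_continuous_on linear_conv_bounded_linear)
  have "(LINT x:ball 0 1|lborel. f (sgn x))
      = (\<integral>x. indicat_real (ball 0 1) x *\<^sub>R f (sgn x) \<partial>distr lborel borel R)"
    by (simp add: set_lebesgue_integral_def distr_orthogonal_transformation[OF R])
  also have "\<dots> = (\<integral>x. indicat_real (ball 0 1) (R x) *\<^sub>R f (sgn (R x)) \<partial>lborel)"
    by (intro integral_distr meas borel_measurable_ball_sgn_compose[OF f])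
  also have "\<dots> = (LINT x:ball 0 1|lborel. f (R (sgn x)))"
    by (simp add: set_lebesgue_integral_def s indicator_def nR)
  finally show ?thesis by (simp add: sphere_integral_def)
qed

text \<open>The flow of \<open>hopf_frame a\<close>, because \<open>hopf_frame a\<close> squares to \<open>- 1\<close>.\<close>

definition rotation :: "3 \<Rightarrow> real \<Rightarrow> real^4 \<Rightarrow> real^4" where
  "rotation a s x = cos s *\<^sub>R x + sin s *\<^sub>R hopf_frame a x"

lemma orthogonal_rotation: "orthogonal_transformation (rotation a s)"
proof -
  have "linear (rotation a s)"
    unfolding rotation_def using hopf_frame_linear[of a]
    by (intro linear_compose_add linear_compose_scale_right linear_id[unfolded id_def])
  moreover have "rotation a s x \<bullet> rotation a s x = x \<bullet> x" for x
  proof -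
    have "rotation a s x \<bullet> rotation a s x = cos s * (cos s * (x \<bullet> x)) + sin s * (sin s * (x \<bullet> x))"
      by (simp add: rotation_def inner_add_left inner_add_right hopf_frame_orthonormal algebra_simps)
    also have "\<dots> = (cos s * cos s + sin s * sin s) * (x \<bullet> x)"
      by (simp only: distrib_right mult.assoc)
    finally show ?thesis by simp
  qed
  ultimately show ?thesis
    by (simp add: orthogonal_transformation norm_eq_sqrt_inner)
qed

lemma rotation_S3: "x \<in> S3 \<Longrightarrow> rotation a s x \<in> S3"
  using orthogonal_transformation_norm[OF orthogonal_rotation] by simp

lemma rotation_0 [simp]: "rotation a 0 x = x"
  by (simp add: rotation_def)

lemma rotation_has_vector_derivative:
  assumes f: "radial_smooth f" and x: "x \<in> S3"
  shows "((\<lambda>s. f (rotation a s x)) has_vector_derivative frame_deriv a f (rotation a s x)) (at s)"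
proof -
  have "((\<lambda>s. rotation a s x) has_vector_derivative hopf_frame a (rotation a s x)) (at s)"
    unfolding rotation_def[abs_def] has_vector_derivative_def
    by (auto intro!: derivative_eq_intros simp: linear_add[OF hopf_frame_linear] linear_cmul[OF hopf_frame_linear]
        hopf_frame_compose algebra_simps)
  moreover have "(f has_derivative frechet_derivative f (at (rotation a s x))) (at (rotation a s x))"
    using radial_smooth_has_derivative[OF f] S3_nonzero[OF rotation_S3[OF x]] by blast
  ultimately show ?thesis
    using vector_derivative_diff_chain_within[of "\<lambda>s. rotation a s x" _ s UNIV f] 
    by (simp add: o_def frame_deriv_def has_derivative_at_withinI)
qed

text \<open>The flow of a frame field is by rotations, which preserve the integral; differentiating
  under the integral sign at time 0 gives the claim.\<close>

lemma sphere_integral_frame_deriv: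
  assumes f: "radial_smooth f"
  shows "sphere_integral (frame_deriv a f) = 0"
proof -
  have cont: "continuous_on S3 f" "continuous_on S3 (frame_deriv a f)"
    using f radial_smooth_frame_deriv[OF f] by (auto intro: radial_smooth_continuous_on)
  have "compact (frame_deriv a f ` S3)" by (rule compact_continuous_image[OF cont(2) compact_sphere])
  then obtain K where K: "\<And>x. x \<in> S3 \<Longrightarrow> norm (frame_deriv a f x) \<le> K"
    by (metis bounded_iff compact_imp_bounded imageI)
  define s where "s n = inverse (real (Suc n))" for n
  have s: "s n > 0" for n by (simp add: s_def)
  have s0: "s \<longlonglongrightarrow> 0" unfolding s_def[abs_def] by (rule LIMSEQ_inverse_real_of_nat)
  define g where "g n x = (f (rotation a (s n) x) - f x) / of_real (s n)" for n x
  have rot_cont: "continuous_on S3 (\<lambda>x. f (rotation a t x))" for t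
  proof (rule continuous_on_compose2[OF cont(1)])
    show "continuous_on S3 (rotation a t)"
      using orthogonal_transformation_linear[OF orthogonal_rotation]
      by (simp add: linear_continuous_on linear_conv_bounded_linear)
  qed (auto simp: orthogonal_transformation_norm[OF orthogonal_rotation])
  have g_cont: "continuous_on S3 (g n)" for n
    unfolding g_def[abs_def] using s[of n] by (intro continuous_intros rot_cont cont) auto
  have g_int: "sphere_integral (g n) = 0" for n
  proof -
    have "g n = (\<lambda>x. inverse (of_real (s n)) * (f (rotation a (s n) x) + (- 1) * f x))"
      by (simp add: g_def[abs_def] divide_inverse mult.commute)
    then have "sphere_integral (g n) = inverse (of_real (s n)) *
      (sphere_integral (\<lambda>x. f (rotation a (s n) x)) + (- 1) * sphere_integral f)"
      using sphere_integral_add[OF rot_cont[of "s n"], of "\<lambda>x. (- 1) * f x"] cont(1)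
      by (simp only: sphere_integral_cmult continuous_on_mult_left)
    then show ?thesis by (simp add: sphere_integral_orthogonal[OF orthogonal_rotation cont(1)])
  qed
  have bound: "norm (g n x) \<le> K" if x: "x \<in> S3" for n x
  proof -
    have "norm (f (rotation a (s n) x) - f (rotation a 0 x)) \<le> K * norm (s n - 0)"
    proof (rule differentiable_bound[where S = UNIV and f = "\<lambda>s. f (rotation a s x)"])
      fix t :: real
      show "((\<lambda>s. f (rotation a s x)) has_derivative (\<lambda>d. d *\<^sub>R frame_deriv a f (rotation a t x))) (at t within UNIV)"
        using rotation_has_vector_derivative[OF f x] by (simp add: has_vector_derivative_def)
      show "onorm (\<lambda>d. d *\<^sub>R frame_deriv a f (rotation a t x)) \<le> K"
        using K[OF rotation_S3[OF x]] by (intro onorm_le) (simp add: mult.commute[of K] mult_left_mono)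
    qed auto
    then show ?thesis using s[of n] by (simp add: g_def norm_divide field_simps)
  qed
  have lim: "(\<lambda>n. g n x) \<longlonglongrightarrow> frame_deriv a f x" if x: "x \<in> S3" for x
  proof -
    have "((\<lambda>t. (f (rotation a t x) - f x) /\<^sub>R t) \<longlongrightarrow> frame_deriv a f x) (at 0)"
    proof -
      have "(\<lambda>t. norm (f (rotation a t x) - f x - t *\<^sub>R frame_deriv a f x) / norm t) \<midarrow>0\<rightarrow> 0"
        using rotation_has_vector_derivative[OF f x, of a 0]
        by (simp add: has_vector_derivative_def has_derivative_at)
      moreover have "\<forall>\<^sub>F t in at 0. norm (f (rotation a t x) - f x - t *\<^sub>R frame_deriv a f x) / norm t
          = norm ((f (rotation a t x) - f x) /\<^sub>R t - frame_deriv a f x)"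
        unfolding eventually_at_filter
      proof (intro always_eventually allI impI)
        fix t :: real assume "t \<noteq> 0"
        then have "(f (rotation a t x) - f x) /\<^sub>R t - frame_deriv a f x
            = inverse t *\<^sub>R (f (rotation a t x) - f x - t *\<^sub>R frame_deriv a f x)"
          by (simp add: scaleR_diff_right)
        then show "norm (f (rotation a t x) - f x - t *\<^sub>R frame_deriv a f x) / norm t
          = norm ((f (rotation a t x) - f x) /\<^sub>R t - frame_deriv a f x)"
          by (simp add: divide_inverse mult.commute)
      qed
      ultimately have "(\<lambda>t. norm ((f (rotation a t x) - f x) /\<^sub>R t - frame_deriv a f x)) \<midarrow>0\<rightarrow> 0"
        using tendsto_cong by force
      then show ?thesis
        using LIM_zero_iff tendsto_norm_zero_iff by blast
    qed
    moreover have "filterlim s (at 0) sequentially"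
      using s0 s by (auto simp: filterlim_at less_imp_neq[symmetric] intro!: always_eventually) 
    ultimately have "(\<lambda>n. (f (rotation a (s n) x) - f x) /\<^sub>R s n) \<longlonglongrightarrow> frame_deriv a f x"
      by (rule filterlim_compose)
    then show ?thesis by (simp add: g_def scaleR_conv_of_real divide_inverse mult.commute)
  qed
  have "(\<lambda>n. LINT x:ball 0 1|lborel. g n (sgn x)) \<longlonglongrightarrow> (LINT x:ball 0 1|lborel. frame_deriv a f (sgn x))"
    unfolding set_lebesgue_integral_def
  proof (rule integral_dominated_convergence[where w = "\<lambda>x. indicat_real (ball 0 1) x *\<^sub>R K"])
    show "(\<lambda>x. indicat_real (ball 0 1) x *\<^sub>R frame_deriv a f (sgn x)) \<in> borel_measurable lborel"
      using borel_measurable_ball_sgn_compose[OF cont(2)] by simp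
    show "(\<lambda>x. indicat_real (ball 0 1) x *\<^sub>R g n (sgn x)) \<in> borel_measurable lborel" for n
      using borel_measurable_ball_sgn_compose[OF g_cont[of n]] by simp
    show "integrable lborel (\<lambda>x::real^4. indicat_real (ball 0 1) x *\<^sub>R K)"
      using integrable_sphere[of "\<lambda>_. K"] by (simp add: set_integrable_def)
    show "AE x in lborel. (\<lambda>n. indicat_real (ball 0 1) x *\<^sub>R g n (sgn x))
        \<longlonglongrightarrow> indicat_real (ball 0 1) x *\<^sub>R frame_deriv a f (sgn x)"
      using AE_nonzero by eventually_elim (intro tendsto_intros lim sgn_S3)
    show "AE x in lborel. norm (indicat_real (ball 0 1) x *\<^sub>R g n (sgn x)) \<le> indicat_real (ball 0 1) x *\<^sub>R K" for n
      using AE_nonzero by eventually_elim (auto simp: indicator_def norm_sgn intro!: bound)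
  qed
  moreover have "(LINT x:ball 0 1|lborel. g n (sgn x)) = 0" for n
    using g_int[of n] by (simp add: sphere_integral_def)
  ultimately have "(LINT x:ball 0 1|lborel. frame_deriv a f (sgn x)) = 0"
    by (simp add: LIMSEQ_const_iff)
  then show ?thesis by (simp add: sphere_integral_def)
qed

text \<open>The form in which integration by parts is used: every integral identity below is a pointwise
  identity of functions up to a divergence.\<close>

lemma sphere_integral_divergence:
  assumes "continuous_on S3 g" and h: "\<And>a. radial_smooth (h a)"
    and eq: "\<And>x. x \<in> S3 \<Longrightarrow> f x = g x + (\<Sum>a\<in>UNIV. frame_deriv a (h a) x)"
  shows "sphere_integral f = sphere_integral g"
proof -
  have c: "continuous_on S3 (frame_deriv a (h a))" for a
    by (intro radial_smooth_continuous_on radial_smooth_frame_deriv h)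
  have "sphere_integral (\<lambda>x. g x + (frame_deriv 1 (h 1) x + (frame_deriv 2 (h 2) x + frame_deriv 3 (h 3) x)))
      = sphere_integral f"
    by (rule sphere_integral_cong) (simp_all add: eq sum_3 assms(1) c continuous_on_add)
  then show ?thesis
    by (simp add: sphere_integral_add assms(1) c continuous_on_add sphere_integral_frame_deriv h)
qed

section \<open>Forms in terms of their components\<close>

definition form0 :: "(real^4 \<Rightarrow> complex) \<Rightarrow> cform" where
  "form0 f x vs = (if x \<in> S3 \<and> length vs = 0 then f x else 0)"

definition form1 :: "(3 \<Rightarrow> real^4 \<Rightarrow> complex) \<Rightarrow> cform" where
  "form1 u x vs =
     (if x \<in> S3 \<and> length vs = 1 \<and> set vs \<subseteq> tangent_space x
      then \<Sum>a\<in>UNIV. of_real (vs ! 0 \<bullet> hopf_frame a x) * u a x else 0)"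

text \<open>With \<open>\<theta> a\<close> the 1-form dual to \<open>hopf_frame a\<close>, this is \<open>\<theta> (a + 1) \<and> \<theta> (a + 2)\<close>. These three span
  the 2-forms at each point, so a 2-form has components indexed by \<open>3\<close> just like a 1-form.\<close>

definition coframe_wedge :: "3 \<Rightarrow> real^4 \<Rightarrow> real^4 \<Rightarrow> real^4 \<Rightarrow> real" where
  "coframe_wedge a x v w =
     (v \<bullet> hopf_frame (a + 1) x) * (w \<bullet> hopf_frame (a + 2) x)
     - (v \<bullet> hopf_frame (a + 2) x) * (w \<bullet> hopf_frame (a + 1) x)"

definition form2 :: "(3 \<Rightarrow> real^4 \<Rightarrow> complex) \<Rightarrow> cform" where
  "form2 w x vs =
     (if x \<in> S3 \<and> length vs = 2 \<and> set vs \<subseteq> tangent_space x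
      then \<Sum>a\<in>UNIV. of_real (coframe_wedge a x (vs ! 0) (vs ! 1)) * w a x else 0)"

lemma sgn_sgn: "sgn (sgn y) = sgn (y::real^4)"
  using S3_sgn[OF sgn_S3[of y]] by (cases "y = 0") simp_all

lemma length_1_conv: "length vs = Suc 0 \<longleftrightarrow> (\<exists>v. vs = [v])"
  by (cases vs) auto

lemma length_2_conv: "length vs = 2 \<longleftrightarrow> (\<exists>v w. vs = [v, w])"
  by (auto simp: length_Suc_conv numeral_2_eq_2)

lemma cform_eqI:
  assumes "\<And>x vs. \<not> (x \<in> S3 \<and> length vs = p \<and> set vs \<subseteq> tangent_space x) \<Longrightarrow> \<omega> x vs = 0 \<and> \<eta> x vs = 0"
    and "\<And>x vs. x \<in> S3 \<Longrightarrow> length vs = p \<Longrightarrow> set vs \<subseteq> tangent_space x \<Longrightarrow> \<omega> x vs = \<eta> x vs"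
  shows "\<omega> = \<eta>"
proof (intro ext)
  fix x vs
  show "\<omega> x vs = \<eta> x vs"
    using assms(1)[of x vs] assms(2)[of x vs] by metis
qed

lemma form0_cong: "(\<And>x. x \<in> S3 \<Longrightarrow> f x = g x) \<Longrightarrow> form0 f = form0 g"
  by (auto simp: form0_def fun_eq_iff)

lemma form1_cong: "(\<And>a x. x \<in> S3 \<Longrightarrow> u a x = v a x) \<Longrightarrow> form1 u = form1 v"
  by (auto simp: form1_def fun_eq_iff intro!: sum.cong)

lemma form2_cong: "(\<And>a x. x \<in> S3 \<Longrightarrow> u a x = v a x) \<Longrightarrow> form2 u = form2 v"
  by (auto simp: form2_def fun_eq_iff intro!: sum.cong)

lemma form1_frame: "x \<in> S3 \<Longrightarrow> form1 u x [hopf_frame a x] = u a x"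
  using exhaust_3[of a] by (auto simp: form1_def hopf_frame_orthonormal norm_eq_1 sum_3)

lemma form1_eq_iff: "form1 u = form1 v \<longleftrightarrow> (\<forall>a. \<forall>x\<in>S3. u a x = v a x)"
proof
  show "form1 u = form1 v" if "\<forall>a. \<forall>x\<in>S3. u a x = v a x"
    using that by (intro form1_cong) blast
qed (metis form1_frame)

text \<open>The derivative at \<open>y\<close> of the retraction \<open>sgn\<close> of the punctured space onto the sphere.\<close>

definition sphere_proj :: "real^4 \<Rightarrow> real^4 \<Rightarrow> real^4" where
  "sphere_proj y v = (v - (v \<bullet> sgn y) *\<^sub>R sgn y) /\<^sub>R norm y"

lemma radial_pullback_eq: "radial_pullback \<omega> y vs = \<omega> (sgn y) (map (sphere_proj y) vs)"
  by (simp add: radial_pullback_def sphere_proj_def[abs_def])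

lemma sphere_proj_tangent: "y \<noteq> 0 \<Longrightarrow> sphere_proj y v \<in> tangent_space (sgn y)"
  using sgn_S3[of y]
  by (simp add: sphere_proj_def tangent_space_def inner_diff_left norm_eq_1)

lemma map_sphere_proj_tangent: "y \<noteq> 0 \<Longrightarrow> set (map (sphere_proj y) vs) \<subseteq> tangent_space (sgn y)"
  by (auto intro: sphere_proj_tangent)

lemma hopf_frame_sgn: "hopf_frame a (sgn y) = inverse (norm y) *\<^sub>R hopf_frame a y"
  by (simp add: sgn_div_norm linear_cmul[OF hopf_frame_linear])

lemma sphere_proj_inner_frame:
  "sphere_proj y v \<bullet> hopf_frame a (sgn y) = (inverse (norm y))\<^sup>2 * (v \<bullet> hopf_frame a y)"
  by (simp add: sphere_proj_def hopf_frame_sgn inner_diff_left power2_eq_square) (simp add: sgn_div_norm)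

lemma sphere_proj_frame: "sphere_proj y (hopf_frame a y) = hopf_frame a (sgn y)"
  by (simp add: sphere_proj_def hopf_frame_sgn) (simp add: sgn_div_norm)

lemma linear_sphere_proj: "linear (sphere_proj y)"
  by (auto intro!: linearI simp: sphere_proj_def inner_add_left algebra_simps)

lemma radial_pullback_form0:
  "y \<noteq> 0 \<Longrightarrow> radial_smooth f \<Longrightarrow> radial_pullback (form0 f) y vs = (if length vs = 0 then f y else 0)"
  using sgn_S3[of y] by (simp add: radial_pullback_eq form0_def radial_smoothD del: mem_sphere)

lemma radial_pullback_form1:
  assumes "y \<noteq> 0" "\<forall>a. radial_smooth (u a)"
  shows "radial_pullback (form1 u) y vs =
    (if length vs = 1 then \<Sum>a\<in>UNIV. ((inverse (norm y))\<^sup>2 * (vs ! 0 \<bullet> hopf_frame a y)) *\<^sub>R u a y else 0)"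
proof (cases "length vs = 1")
  case True
  then show ?thesis
    using sgn_S3[OF assms(1)] map_sphere_proj_tangent[OF assms(1), of vs] assms(2)
    by (simp add: radial_pullback_eq form1_def sphere_proj_inner_frame radial_smoothD scaleR_conv_of_real
        del: mem_sphere)
qed (auto simp: radial_pullback_eq form1_def)

lemma form0_smooth:
  assumes "radial_smooth f" shows "form0 f \<in> smooth_forms 0"
proof -
  have "smooth_on (\<lambda>y. radial_pullback (form0 f) y vs) (- {0})" for vs
    by (rule smooth_on_cong[where f = "if length vs = 0 then f else (\<lambda>_. 0)"])
      (use assms in \<open>auto simp: radial_pullback_form0 radial_smooth_def smooth_on_const\<close>)
  then show ?thesis by (auto simp: smooth_forms_def alternating_form_def form0_def)
qed

lemma form1_smooth:
  assumes u: "\<forall>a. radial_smooth (u a)" shows "form1 u \<in> smooth_forms 1"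
proof -
  have "smooth_on (\<lambda>y. radial_pullback (form1 u) y vs) (- {0})" for vs
  proof (cases "length vs = 1")
    case True
    have l: "smooth_on (\<lambda>y. vs ! 0 \<bullet> hopf_frame a y) (- {0})" for a
      by (intro smooth_on_linear open_punctured
          bounded_linear_compose[OF bounded_linear_inner_right bounded_linear_hopf_frame, unfolded o_def])
    have us: "smooth_on (u a) (- {0})" for a using u by (simp add: radial_smooth_def)
    have "smooth_on (\<lambda>y. \<Sum>a\<in>UNIV. ((inverse (norm y) * inverse (norm y)) * (vs ! 0 \<bullet> hopf_frame a y)) *\<^sub>R u a y) (- {0})"
      by (intro smooth_on_sum smooth_on_bounded_bilinear[OF bounded_bilinear_scaleR]
          smooth_on_bounded_bilinear[OF bounded_bilinear_mult] smooth_on_inverse_norm open_punctured l us)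
    then show ?thesis
      by (rule smooth_on_cong[rotated])
        (use True u in \<open>auto simp: radial_pullback_form1 power2_eq_square\<close>)
  next
    case False
    show ?thesis
      by (rule smooth_on_cong[where f = "\<lambda>_. 0"])
        (use False u in \<open>auto simp: radial_pullback_form1 smooth_on_const\<close>)
  qed
  moreover have "alternating_form 1 (form1 u)"
    unfolding alternating_form_def
  proof (intro conjI allI ballI impI)
    fix x vs i a b and v w :: "real^4"
    assume x: "x \<in> S3" "length vs = 1 \<and> set vs \<subseteq> tangent_space x" "i < (1::nat)"
      and v: "v \<in> tangent_space x" "w \<in> tangent_space x"
    obtain z where "vs = [z]" using x by (auto simp: length_1_conv)
    moreover have "a *\<^sub>R v + b *\<^sub>R w \<in> tangent_space x"
      using v by (simp add: tangent_space_def inner_add_left)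
    ultimately show "form1 u x (vs[i := a *\<^sub>R v + b *\<^sub>R w])
        = of_real a * form1 u x (vs[i := v]) + of_real b * form1 u x (vs[i := w])"
      using x v by (simp add: form1_def sum_3 inner_add_left algebra_simps)
  qed (auto simp: form1_def)
  ultimately show ?thesis by (simp add: smooth_forms_def)
qed

lemma smooth_forms_0E:
  assumes "\<omega> \<in> smooth_forms 0"
  obtains f where "radial_smooth f" "\<omega> = form0 f"
proof
  let ?f = "\<lambda>y. radial_pullback \<omega> y []"
  have a: "alternating_form 0 \<omega>" and s: "smooth_on ?f (- {0})"
    using assms by (auto simp: smooth_forms_def)
  show "radial_smooth ?f" using s by (simp add: radial_smooth_def radial_pullback_eq sgn_sgn)
  show "\<omega> = form0 ?f"
  proof (rule cform_eqI[where p = 0])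
    show "\<omega> x vs = 0 \<and> form0 ?f x vs = 0"
      if "\<not> (x \<in> S3 \<and> length vs = 0 \<and> set vs \<subseteq> tangent_space x)" for x vs
      using that a unfolding alternating_form_def form0_def by auto
  qed (auto simp: form0_def radial_pullback_def)
qed

text \<open>The components are the values on the frame. They are smooth because \<open>radial_pullback \<omega> y [v]\<close> is linear
  in \<open>v\<close>, which reduces them to the values on the constant basis vectors of four-space.\<close>

lemma smooth_forms_1E:
  assumes "\<omega> \<in> smooth_forms 1"
  obtains u where "\<forall>a. radial_smooth (u a)" "\<omega> = form1 u"
proof
  define u where "u a y = \<omega> (sgn y) [hopf_frame a (sgn y)]" for a y
  have s: "smooth_on (\<lambda>y. radial_pullback \<omega> y vs) (- {0})" for vs
    using assms by (auto simp: smooth_forms_def)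
  have alt: "alternating_form 1 \<omega>" using assms by (simp add: smooth_forms_def)
  have lin: "\<omega> x [a *\<^sub>R v + b *\<^sub>R w] = of_real a * \<omega> x [v] + of_real b * \<omega> x [w]"
    if "x \<in> S3" "v \<in> tangent_space x" "w \<in> tangent_space x" for x v w a b
  proof -
    have "length [v] = 1 \<and> set [v] \<subseteq> tangent_space x" using that by simp
    with alt that have "\<forall>i<1. \<forall>u\<in>tangent_space x. \<forall>w\<in>tangent_space x. \<forall>a b :: real.
           \<omega> x ([v][i := a *\<^sub>R u + b *\<^sub>R w])
             = of_real a * \<omega> x ([v][i := u]) + of_real b * \<omega> x ([v][i := w])"
      unfolding alternating_form_def by blast
    with that show ?thesis by simp
  qed
  have "linear (\<lambda>v. radial_pullback \<omega> y [v])" if "y \<noteq> 0" for y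
  proof (rule linearI)
    fix v w :: "real^4" and c :: real
    note l = lin[OF sgn_S3[OF that] sphere_proj_tangent[OF that] sphere_proj_tangent[OF that]]
    show "radial_pullback \<omega> y [v + w] = radial_pullback \<omega> y [v] + radial_pullback \<omega> y [w]"
      using l[of 1 v 1 w] by (simp add: radial_pullback_eq linear_add[OF linear_sphere_proj])
    show "radial_pullback \<omega> y [c *\<^sub>R v] = c *\<^sub>R radial_pullback \<omega> y [v]"
      using l[of c v 0 v] by (simp add: radial_pullback_eq linear_cmul[OF linear_sphere_proj]
          scaleR_conv_of_real[where 'a = complex])
  qed
  then have u_eq: "u a y = (\<Sum>e\<in>Basis. (hopf_frame a y \<bullet> e) *\<^sub>R radial_pullback \<omega> y [e])" if "y \<noteq> 0" for a y
  proof -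
    assume l: "\<And>y. y \<noteq> 0 \<Longrightarrow> linear (\<lambda>v. radial_pullback \<omega> y [v])"
    have "u a y = radial_pullback \<omega> y [hopf_frame a y]"
      by (simp add: u_def radial_pullback_eq sphere_proj_frame)
    also have "\<dots> = radial_pullback \<omega> y [\<Sum>e\<in>Basis. (hopf_frame a y \<bullet> e) *\<^sub>R e]"
      by (simp add: euclidean_representation)
    finally show ?thesis by (simp add: linear_sum[OF l[OF that]] linear_cmul[OF l[OF that]])
  qed
  have "smooth_on (\<lambda>y. \<Sum>e\<in>Basis. (hopf_frame a y \<bullet> e) *\<^sub>R radial_pullback \<omega> y [e]) (- {0})" for a
    by (intro smooth_on_sum smooth_on_bounded_bilinear[OF bounded_bilinear_scaleR] smooth_on_linear s
        open_punctured bounded_linear_compose[OF bounded_linear_inner_left bounded_linear_hopf_frame, unfolded o_def])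
  then have "smooth_on (u a) (- {0})" for a
    by (rule smooth_on_cong[rotated]) (auto simp: u_eq)
  then show "\<forall>a. radial_smooth (u a)" by (simp add: radial_smooth_def u_def sgn_sgn)
  show "\<omega> = form1 u"
  proof (rule cform_eqI[where p = 1])
    show "\<omega> x vs = 0 \<and> form1 u x vs = 0"
      if "\<not> (x \<in> S3 \<and> length vs = 1 \<and> set vs \<subseteq> tangent_space x)" for x vs
      using that alt unfolding alternating_form_def form1_def by auto
  next
    fix x :: "real^4" and vs
    assume x: "x \<in> S3" and "length vs = 1" and t: "set vs \<subseteq> tangent_space x"
    then obtain v where v: "vs = [v]" by (auto simp: length_1_conv)
    let ?p = "\<lambda>a. v \<bullet> hopf_frame a x"
    have "v = ?p 1 *\<^sub>R hopf_frame 1 x + 1 *\<^sub>R (?p 2 *\<^sub>R hopf_frame 2 x + ?p 3 *\<^sub>R hopf_frame 3 x)"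
      using tangent_expansion[OF x, of v] t v by (simp add: sum_3 add.assoc)
    moreover have "?p 2 *\<^sub>R hopf_frame 2 x + ?p 3 *\<^sub>R hopf_frame 3 x \<in> tangent_space x"
      by (simp add: tangent_space_def inner_add_left)
    ultimately have "\<omega> x [v] = of_real (?p 1) * u 1 x + (of_real (?p 2) * u 2 x + of_real (?p 3) * u 3 x)"
      using x by (metis (no_types, lifting) lin hopf_frame_tangent S3_sgn u_def of_real_1 mult_1)
    then show "\<omega> x vs = form1 u x vs"
      using x v t by (simp add: form1_def sum_3)
  qed
qed

section \<open>The L2 products in components\<close>

lemma S3_inner_self: "x \<in> S3 \<Longrightarrow> x \<bullet> x = 1"
  by (simp add: norm_eq_1)

lemma sphere_proj_S3_inner: "x \<in> S3 \<Longrightarrow> sphere_proj x v \<bullet> hopf_frame a x = v \<bullet> hopf_frame a x"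
  using sphere_proj_inner_frame[of x v a] by simp

lemma sum_Basis_frame:
  "x \<in> S3 \<Longrightarrow> (\<Sum>e\<in>Basis. (e \<bullet> hopf_frame a x) * (e \<bullet> hopf_frame b x)) = (if a = b then 1 else 0)"
proof -
  assume x: "x \<in> S3"
  have "(\<Sum>e\<in>Basis. (e \<bullet> hopf_frame a x) * (e \<bullet> hopf_frame b x)) = hopf_frame a x \<bullet> hopf_frame b x"
    by (subst euclidean_inner) (simp add: inner_commute)
  then show ?thesis by (simp only: hopf_frame_orthonormal S3_inner_self[OF x])
qed

lemma form_inner_0:
  "x \<in> S3 \<Longrightarrow> form_inner 0 (form0 f) (form0 g) x = f x * cnj (g x)"
proof -
  assume x: "x \<in> S3"
  have "{es :: (real^4) list. length es = 0 \<and> set es \<subseteq> Basis} = {[]}" by auto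
  with x show ?thesis by (simp add: form_inner_def radial_pullback_eq form0_def)
qed

lemma form_inner_1:
  assumes x: "x \<in> S3"
  shows "form_inner 1 (form1 u) (form1 v) x = (\<Sum>a\<in>UNIV. u a x * cnj (v a x))"
proof -
  have set: "{es :: (real^4) list. length es = 1 \<and> set es \<subseteq> Basis} = (\<lambda>e. [e]) ` Basis"
    by (auto simp: length_Suc_conv)
  have pb: "radial_pullback (form1 u) x [e] = (\<Sum>a\<in>UNIV. of_real (e \<bullet> hopf_frame a x) * u a x)" for u e
    using x sphere_proj_tangent[of x e] S3_nonzero[OF x]
    by (simp add: radial_pullback_eq form1_def sphere_proj_S3_inner)
  have "form_inner 1 (form1 u) (form1 v) x
      = (\<Sum>e\<in>Basis. (\<Sum>a\<in>UNIV. of_real (e \<bullet> hopf_frame a x) * u a x) *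
           (\<Sum>b\<in>UNIV. of_real (e \<bullet> hopf_frame b x) * cnj (v b x)))"
    unfolding form_inner_def set by (subst sum.reindex) (auto simp: inj_on_def pb)
  also have "\<dots> = (\<Sum>e\<in>Basis. \<Sum>a\<in>UNIV. \<Sum>b\<in>UNIV. of_real ((e \<bullet> hopf_frame a x) * (e \<bullet> hopf_frame b x)) * (u a x * cnj (v b x)))"
    by (simp add: sum_product mult_ac)
  also have "\<dots> = (\<Sum>a\<in>UNIV. \<Sum>b\<in>UNIV. \<Sum>e\<in>Basis. of_real ((e \<bullet> hopf_frame a x) * (e \<bullet> hopf_frame b x)) * (u a x * cnj (v b x)))"
    by (subst sum.swap, rule sum.cong, simp, rule sum.swap)
  also have "\<dots> = (\<Sum>a\<in>UNIV. \<Sum>b\<in>UNIV. of_real (\<Sum>e\<in>Basis. (e \<bullet> hopf_frame a x) * (e \<bullet> hopf_frame b x)) * (u a x * cnj (v b x)))"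
    by (simp only: sum_distrib_right[symmetric] of_real_sum)
  also have "\<dots> = (\<Sum>a\<in>UNIV. u a x * cnj (v a x))"
    by (simp add: sum_Basis_frame[OF x] sum_3)
  finally show ?thesis .
qed

text \<open>The value 2 on the diagonal cancels the \<open>fact 2\<close> in \<open>form_inner 2\<close>.\<close>

lemma sum_Basis_coframe_wedge:
  assumes x: "x \<in> S3"
  shows "(\<Sum>e\<in>Basis. \<Sum>e'\<in>Basis. coframe_wedge a x e e' * coframe_wedge b x e e') = (if a = b then 2 else 0)"
proof -
  let ?p = "\<lambda>a e. e \<bullet> hopf_frame a x"
  let ?g = "\<lambda>a b. \<Sum>e\<in>Basis. ?p a e * ?p b e"
  have "(\<Sum>e\<in>Basis. \<Sum>e'\<in>Basis. coframe_wedge a x e e' * coframe_wedge b x e e')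
    = (\<Sum>e\<in>Basis. \<Sum>e'\<in>Basis.
         (?p (a + 1) e * ?p (b + 1) e) * (?p (a + 2) e' * ?p (b + 2) e')
       - (?p (a + 1) e * ?p (b + 2) e) * (?p (a + 2) e' * ?p (b + 1) e')
       - (?p (a + 2) e * ?p (b + 1) e) * (?p (a + 1) e' * ?p (b + 2) e')
       + (?p (a + 2) e * ?p (b + 2) e) * (?p (a + 1) e' * ?p (b + 1) e'))"
    by (intro sum.cong refl) (simp add: coframe_wedge_def algebra_simps)
  also have "\<dots> = ?g (a + 1) (b + 1) * ?g (a + 2) (b + 2) - ?g (a + 1) (b + 2) * ?g (a + 2) (b + 1)
      - ?g (a + 2) (b + 1) * ?g (a + 1) (b + 2) + ?g (a + 2) (b + 2) * ?g (a + 1) (b + 1)"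
    by (simp only: sum.distrib sum_subtractf sum_distrib_left[symmetric] sum_distrib_right[symmetric])
  also have "\<dots> = (if a = b then 2 else 0)"
    unfolding sum_Basis_frame[OF x] using exhaust_3[of a] exhaust_3[of b]
    by (elim disjE) (simp_all add: cyclic_index del: one_add_one)
  finally show ?thesis .
qed

lemma form_inner_2:
  assumes x: "x \<in> S3"
  shows "form_inner 2 (form2 u) (form2 v) x = (\<Sum>a\<in>UNIV. u a x * cnj (v a x))"
proof -
  have set: "{es :: (real^4) list. length es = 2 \<and> set es \<subseteq> Basis} = (\<lambda>(e, e'). [e, e']) ` (Basis \<times> Basis)"
    by (auto simp: length_2_conv)
  have pb: "radial_pullback (form2 u) x [e, e'] = (\<Sum>a\<in>UNIV. of_real (coframe_wedge a x e e') * u a x)" for u e e'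
    using x sphere_proj_tangent[of x e] sphere_proj_tangent[of x e'] S3_nonzero[OF x]
    by (simp add: radial_pullback_eq form2_def coframe_wedge_def sphere_proj_S3_inner)
  let ?w = "\<lambda>a e e'. coframe_wedge a x e e'"
  have "form_inner 2 (form2 u) (form2 v) x
      = (\<Sum>(e, e')\<in>Basis \<times> Basis. (\<Sum>a\<in>UNIV. of_real (?w a e e') * u a x) *
           (\<Sum>b\<in>UNIV. of_real (?w b e e') * cnj (v b x))) / 2"
    unfolding form_inner_def set
    by (subst sum.reindex) (auto simp: inj_on_def pb fact_numeral intro!: sum.cong)
  also have "\<dots> = (\<Sum>e\<in>Basis. \<Sum>e'\<in>Basis. \<Sum>a\<in>UNIV. \<Sum>b\<in>UNIV. of_real (?w a e e' * ?w b e e') * (u a x * cnj (v b x))) / 2"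
    by (simp add: sum_product sum.cartesian_product[symmetric] mult_ac)
  also have "\<dots> = (\<Sum>a\<in>UNIV. \<Sum>b\<in>UNIV. \<Sum>e\<in>Basis. \<Sum>e'\<in>Basis. of_real (?w a e e' * ?w b e e') * (u a x * cnj (v b x))) / 2"
    unfolding sum_3 sum.distrib by (simp only: add_ac)
  also have "\<dots> = (\<Sum>a\<in>UNIV. \<Sum>b\<in>UNIV. of_real (\<Sum>e\<in>Basis. \<Sum>e'\<in>Basis. ?w a e e' * ?w b e e') * (u a x * cnj (v b x))) / 2"
    by (simp only: sum_distrib_right[symmetric] of_real_sum)
  also have "\<dots> = (\<Sum>a\<in>UNIV. u a x * cnj (v a x))"
    by (simp add: sum_Basis_coframe_wedge[OF x] sum_3)
  finally show ?thesis .
qed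

definition field_inner :: "(3 \<Rightarrow> real^4 \<Rightarrow> complex) \<Rightarrow> (3 \<Rightarrow> real^4 \<Rightarrow> complex) \<Rightarrow> complex" where
  "field_inner u v = sphere_integral (\<lambda>x. \<Sum>a\<in>UNIV. u a x * cnj (v a x))"

lemmas radial_smooth_intros = radial_smooth_const radial_smooth_add radial_smooth_diff radial_smooth_minus
  radial_smooth_mult radial_smooth_cnj radial_smooth_sum radial_smooth_frame_deriv

lemma L2_inner_0:
  "radial_smooth f \<Longrightarrow> radial_smooth g \<Longrightarrow>
    L2_inner 0 (form0 f) (form0 g) = sphere_integral (\<lambda>x. f x * cnj (g x))"
  unfolding L2_inner_def
  by (rule sphere_integral_cong[symmetric])
    (auto simp: form_inner_0 simp del: mem_sphere intro!: radial_smooth_continuous_on radial_smooth_intros)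

lemma L2_inner_1:
  "\<forall>a. radial_smooth (u a) \<Longrightarrow> \<forall>a. radial_smooth (v a) \<Longrightarrow>
    L2_inner 1 (form1 u) (form1 v) = field_inner u v"
  unfolding L2_inner_def field_inner_def
  by (rule sphere_integral_cong[symmetric])
    (auto simp: form_inner_1[simplified] simp del: mem_sphere intro!: radial_smooth_continuous_on radial_smooth_intros)

lemma L2_inner_2:
  "\<forall>a. radial_smooth (u a) \<Longrightarrow> \<forall>a. radial_smooth (v a) \<Longrightarrow>
    L2_inner 2 (form2 u) (form2 v) = field_inner u v"
  unfolding L2_inner_def field_inner_def
  by (rule sphere_integral_cong[symmetric])
    (auto simp: form_inner_2 simp del: mem_sphere intro!: radial_smooth_continuous_on radial_smooth_intros)

section \<open>The differential and the codifferential in components\<close>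

text \<open>The Hodge dual of the exterior derivative of the 1-form with components \<open>u\<close>. The term of order zero comes
  from \<open>[E\<^sub>a, E\<^sub>a\<^sub>+\<^sub>1] = 2 E\<^sub>a\<^sub>+\<^sub>2\<close>.\<close>

definition frame_curl :: "(3 \<Rightarrow> real^4 \<Rightarrow> complex) \<Rightarrow> 3 \<Rightarrow> real^4 \<Rightarrow> complex" where
  "frame_curl u a x = frame_deriv (a + 1) (u (a + 2)) x - frame_deriv (a + 2) (u (a + 1)) x - 2 * u a x"

definition frame_div :: "(3 \<Rightarrow> real^4 \<Rightarrow> complex) \<Rightarrow> real^4 \<Rightarrow> complex" where
  "frame_div u x = (\<Sum>a\<in>UNIV. frame_deriv a (u a) x)"

lemma radial_smooth_frame_curl: "\<forall>a. radial_smooth (u a) \<Longrightarrow> radial_smooth (frame_curl u a)"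
  unfolding frame_curl_def by (auto intro!: radial_smooth_intros)

lemma radial_smooth_frame_div: "\<forall>a. radial_smooth (u a) \<Longrightarrow> radial_smooth (frame_div u)"
  unfolding frame_div_def by (auto intro!: radial_smooth_intros)

lemma drop_nth_simps: "drop_nth 0 (v # vs) = vs" "drop_nth (Suc i) (v # vs) = v # drop_nth i vs"
  by (simp_all add: drop_nth_def)

lemma length_drop_nth: "i < length vs \<Longrightarrow> length (drop_nth i vs) = length vs - 1"
  by (simp add: drop_nth_def)

lemma frechet_derivative_punctured_cong:
  assumes "x \<in> S3" "(f has_derivative f') (at x)" "\<And>y. y \<noteq> 0 \<Longrightarrow> f y = g y"
  shows "frechet_derivative g (at x) = f'"
proof -
  have "(g has_derivative f') (at x)"
    by (rule has_derivative_transform_within_open[OF assms(2) open_punctured]) (use assms in auto)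
  then show ?thesis using frechet_derivative_at by metis
qed

lemma ext_deriv_wrong_length:
  assumes "\<And>x vs. x \<in> S3 \<Longrightarrow> length vs \<noteq> p \<Longrightarrow> \<omega> x vs = 0" "length vs \<noteq> Suc p"
  shows "ext_deriv \<omega> x vs = 0"
proof -
  have "frechet_derivative (\<lambda>y. radial_pullback \<omega> y (drop_nth i vs)) (at x) (vs ! i) = 0"
    if "x \<in> S3" "i < length vs" for i
  proof -
    have "length (drop_nth i vs) \<noteq> p" using that assms(2) by (simp add: length_drop_nth)
    then have "frechet_derivative (\<lambda>y. radial_pullback \<omega> y (drop_nth i vs)) (at x) = (\<lambda>_. 0)"
      by (intro frechet_derivative_punctured_cong[OF that(1) has_derivative_const])
        (simp add: radial_pullback_eq assms(1)[OF sgn_S3])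
    then show ?thesis by simp
  qed
  then show ?thesis by (simp add: ext_deriv_def)
qed

lemma ext_deriv_form0:
  assumes f: "radial_smooth f"
  shows "ext_deriv (form0 f) = form1 (\<lambda>a. frame_deriv a f)"
proof (rule cform_eqI[where p = 1])
  fix x :: "real^4" and vs
  assume "\<not> (x \<in> S3 \<and> length vs = 1 \<and> set vs \<subseteq> tangent_space x)"
  then show "ext_deriv (form0 f) x vs = 0 \<and> form1 (\<lambda>a. frame_deriv a f) x vs = 0"
    using ext_deriv_wrong_length[of 0 "form0 f" vs x] by (auto simp: ext_deriv_def form1_def form0_def)
next
  fix x :: "real^4" and vs
  assume x: "x \<in> S3" and "length vs = 1" and t: "set vs \<subseteq> tangent_space x"
  then obtain v where v: "vs = [v]" by (auto simp: length_1_conv)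
  have "frechet_derivative (\<lambda>y. radial_pullback (form0 f) y []) (at x) = frechet_derivative f (at x)"
    by (rule frechet_derivative_punctured_cong[OF x radial_smooth_has_derivative[OF f S3_nonzero[OF x]]])
      (simp add: radial_pullback_form0[OF _ f])
  moreover have "frechet_derivative f (at x) v
      = frechet_derivative f (at x) (\<Sum>a\<in>UNIV. (v \<bullet> hopf_frame a x) *\<^sub>R hopf_frame a x)"
    using tangent_expansion[OF x, of v] v t by simp
  moreover have l: "linear (frechet_derivative f (at x))"
    using radial_smooth_has_derivative[OF f S3_nonzero[OF x]] by (rule has_derivative_linear)
  ultimately show "ext_deriv (form0 f) x vs = form1 (\<lambda>a. frame_deriv a f) x vs"
    using x t v
    by (simp add: ext_deriv_def form1_def drop_nth_simps linear_sum[OF l] linear_cmul[OF l] frame_deriv_def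
        scaleR_conv_of_real[where 'a = complex])
qed

lemma frechet_derivative_pullback_form1:
  assumes u: "\<forall>a. radial_smooth (u a)" and x: "x \<in> S3" and v: "v \<in> tangent_space x"
  shows "frechet_derivative (\<lambda>y. radial_pullback (form1 u) y [w]) (at x) v
    = (\<Sum>a\<in>UNIV. of_real (w \<bullet> hopf_frame a v) * u a x
          + of_real (w \<bullet> hopf_frame a x) * frechet_derivative (u a) (at x) v)"
proof -
  have x0: "x \<noteq> 0" using x by auto
  have r: "((\<lambda>x. inverse (norm x)) has_derivative (\<lambda>v. - (v \<bullet> x))) (at x)"
    using has_derivative_inverse_norm[OF x0] x by (simp add: inner_commute)
  have j: "((\<lambda>y. w \<bullet> hopf_frame a y) has_derivative (\<lambda>v. w \<bullet> hopf_frame a v)) (at x)" for a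
    by (intro bounded_linear.has_derivative[OF bounded_linear_inner_right]
        bounded_linear.has_derivative[OF bounded_linear_hopf_frame] has_derivative_ident)
  have "((\<lambda>y. \<Sum>a\<in>UNIV. ((inverse (norm y) * inverse (norm y)) * (w \<bullet> hopf_frame a y)) *\<^sub>R u a y) has_derivative
    (\<lambda>v. \<Sum>a\<in>UNIV. ((inverse (norm x) * inverse (norm x)) * (w \<bullet> hopf_frame a x)) *\<^sub>R frechet_derivative (u a) (at x) v
       + ((inverse (norm x) * inverse (norm x)) * (w \<bullet> hopf_frame a v)
          + (inverse (norm x) * - (v \<bullet> x) + - (v \<bullet> x) * inverse (norm x)) * (w \<bullet> hopf_frame a x)) *\<^sub>R u a x)) (at x)"
    by (intro has_derivative_sum has_derivative_scaleR has_derivative_mult r j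
        radial_smooth_has_derivative u[rule_format] x0)
  from frechet_derivative_punctured_cong[OF x this, of "\<lambda>y. radial_pullback (form1 u) y [w]"]
  show ?thesis using x v
    by (simp add: radial_pullback_form1[OF _ u] power2_eq_square tangent_space_def
        scaleR_conv_of_real[where 'a = complex] sum.distrib add.commute)
qed

text \<open>On tangent vectors the frame acts as an infinitesimal rotation, with axis the frame vector itself.\<close>

lemma inner_frame_tangent:
  assumes x: "x \<in> S3" and v: "v \<in> tangent_space x" and w: "w \<in> tangent_space x"
  shows "w \<bullet> hopf_frame a v = - coframe_wedge a x v w"
proof -
  let ?p = "\<lambda>a. v \<bullet> hopf_frame a x"
  have "w \<bullet> hopf_frame a v = w \<bullet> hopf_frame a (?p 1 *\<^sub>R hopf_frame 1 x + ?p 2 *\<^sub>R hopf_frame 2 x + ?p 3 *\<^sub>R hopf_frame 3 x)"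
    using tangent_expansion[OF x v] by (simp add: sum_3)
  also have "\<dots> = - coframe_wedge a x v w"
    using exhaust_3[of a] w hopf_frame_compose[of 1 x] hopf_frame_compose[of 2 x] hopf_frame_compose[of 3 x]
    by (elim disjE)
      (simp_all add: linear_add[OF hopf_frame_linear] linear_cmul[OF hopf_frame_linear] coframe_wedge_def
        cyclic_index inner_add_right inner_diff_right tangent_space_def del: one_add_one)
  finally show ?thesis .
qed

text \<open>Differentiating the pullback of \<open>form1 u\<close> hits either the components \<open>u\<close>, which gives the first-order
  part of the curl, or the linear frame fields, which give its term of order zero by
  \<open>inner_frame_tangent\<close>.\<close>

lemma ext_deriv_form1:
  assumes u: "\<forall>a. radial_smooth (u a)"
  shows "ext_deriv (form1 u) = form2 (frame_curl u)"
proof (rule cform_eqI[where p = 2])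
  fix x :: "real^4" and vs
  assume "\<not> (x \<in> S3 \<and> length vs = 2 \<and> set vs \<subseteq> tangent_space x)"
  then show "ext_deriv (form1 u) x vs = 0 \<and> form2 (frame_curl u) x vs = 0"
    using ext_deriv_wrong_length[of 1 "form1 u" vs x] by (auto simp: ext_deriv_def form1_def form2_def)
next
  fix x :: "real^4" and vs
  assume x: "x \<in> S3" and "length vs = 2" and t: "set vs \<subseteq> tangent_space x"
  then obtain v w where vs: "vs = [v, w]" by (auto simp: length_2_conv)
  then have v: "v \<in> tangent_space x" and w: "w \<in> tangent_space x" using t by auto
  let ?p = "\<lambda>a. of_real (v \<bullet> hopf_frame a x)" and ?q = "\<lambda>a. of_real (w \<bullet> hopf_frame a x)"
  have D: "frechet_derivative (u b) (at x) z = (\<Sum>a\<in>UNIV. of_real (z \<bullet> hopf_frame a x) * frame_deriv a (u b) x)"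
    if "z \<in> tangent_space x" for z b
  proof -
    have l: "linear (frechet_derivative (u b) (at x))"
      using radial_smooth_has_derivative[OF u[rule_format] S3_nonzero[OF x]] by (rule has_derivative_linear)
    have "frechet_derivative (u b) (at x) z
        = frechet_derivative (u b) (at x) (\<Sum>a\<in>UNIV. (z \<bullet> hopf_frame a x) *\<^sub>R hopf_frame a x)"
      using tangent_expansion[OF x that] by simp
    then show ?thesis
      by (simp add: linear_sum[OF l] linear_cmul[OF l] frame_deriv_def scaleR_conv_of_real[where 'a = complex])
  qed
  have "ext_deriv (form1 u) x vs = (\<Sum>b\<in>UNIV.
      of_real (w \<bullet> hopf_frame b v) * u b x + ?q b * (\<Sum>a\<in>UNIV. ?p a * frame_deriv a (u b) x))
    - (\<Sum>b\<in>UNIV. of_real (v \<bullet> hopf_frame b w) * u b x + ?p b * (\<Sum>a\<in>UNIV. ?q a * frame_deriv a (u b) x))"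
    using x t vs
    by (simp add: ext_deriv_def drop_nth_simps frechet_derivative_pullback_form1[OF u x v]
        frechet_derivative_pullback_form1[OF u x w] D[OF v] D[OF w] numeral_2_eq_2 lessThan_Suc)
  also have "\<dots> = form2 (frame_curl u) x vs"
    unfolding inner_frame_tangent[OF x v w] inner_frame_tangent[OF x w v] using x t vs
    by (simp add: form2_def frame_curl_def sum_3 coframe_wedge_def cyclic_index algebra_simps del: one_add_one)
  finally show "ext_deriv (form1 u) x vs = form2 (frame_curl u) x vs" .
qed

lemma sphere_integral_norm_eq_0:
  assumes f: "radial_smooth f" and "sphere_integral (\<lambda>x. f x * cnj (f x)) = 0" and "x \<in> S3"
  shows "f x = 0"
proof -
  have "(cmod (f x))\<^sup>2 = 0"
  proof (rule sphere_integral_of_real_eq_0[where f = "\<lambda>x. (cmod (f x))\<^sup>2"])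
    show "continuous_on S3 (\<lambda>x. (cmod (f x))\<^sup>2)"
      by (intro continuous_intros radial_smooth_continuous_on f)
  qed (use assms in \<open>simp_all only: complex_norm_square, auto\<close>)
  then show ?thesis by simp
qed

lemma field_inner_eq_0:
  assumes u: "\<forall>a. radial_smooth (u a)" and 0: "field_inner u u = 0" and "x \<in> S3"
  shows "u a x = 0"
proof -
  have "(\<Sum>a\<in>UNIV. (cmod (u a x))\<^sup>2) = 0"
  proof (rule sphere_integral_of_real_eq_0[where f = "\<lambda>x. \<Sum>a\<in>UNIV. (cmod (u a x))\<^sup>2"])
    show "continuous_on S3 (\<lambda>x. \<Sum>a\<in>UNIV. (cmod (u a x))\<^sup>2)"
      using u by (auto intro!: continuous_intros radial_smooth_continuous_on)
    show "sphere_integral (\<lambda>x. of_real (\<Sum>a\<in>UNIV. (cmod (u a x))\<^sup>2)) = 0"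
      using 0 unfolding field_inner_def by (simp only: of_real_sum complex_norm_square)
  qed (use assms in \<open>auto intro: sum_nonneg\<close>)
  then show ?thesis by (simp add: sum_nonneg_eq_0_iff)
qed

text \<open>Nondegeneracy of the L2 product, tested on the difference of the two forms. This and its
  analogue for 1-forms make the definite description in \<open>codiff\<close> meaningful.\<close>

lemma L2_0_unique:
  assumes f: "radial_smooth f" and g: "radial_smooth g"
    and eq: "\<And>\<phi>. \<phi> \<in> smooth_forms 0 \<Longrightarrow> L2_inner 0 \<phi> (form0 f) = L2_inner 0 \<phi> (form0 g)"
  shows "form0 f = form0 g"
proof (rule form0_cong)
  fix x :: "real^4" assume x: "x \<in> S3"
  let ?h = "\<lambda>x. f x - g x"
  have h: "radial_smooth ?h" by (intro radial_smooth_intros f g)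
  have c: "continuous_on S3 (\<lambda>x. ?h x * cnj (f x))" "continuous_on S3 (\<lambda>x. - 1 * (?h x * cnj (g x)))"
    by (intro radial_smooth_continuous_on radial_smooth_intros f g)+
  have "sphere_integral (\<lambda>x. ?h x * cnj (?h x)) = sphere_integral (\<lambda>x. ?h x * cnj (f x) + - 1 * (?h x * cnj (g x)))"
    by (simp add: algebra_simps)
  also have "\<dots> = sphere_integral (\<lambda>x. ?h x * cnj (f x)) + - 1 * sphere_integral (\<lambda>x. ?h x * cnj (g x))"
    by (simp only: sphere_integral_add[OF c] sphere_integral_cmult)
  also have "\<dots> = 0"
    using eq[OF form0_smooth[OF h]] by (simp add: L2_inner_0 h f g)
  finally show "f x = g x" using sphere_integral_norm_eq_0[OF h _ x] by simp
qed

lemma L2_1_unique: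
  assumes u: "\<forall>a. radial_smooth (u a)" and v: "\<forall>a. radial_smooth (v a)"
    and eq: "\<And>\<phi>. \<phi> \<in> smooth_forms 1 \<Longrightarrow> L2_inner 1 \<phi> (form1 u) = L2_inner 1 \<phi> (form1 v)"
  shows "form1 u = form1 v"
proof (rule form1_cong)
  fix a and x :: "real^4" assume x: "x \<in> S3"
  let ?h = "\<lambda>a x. u a x - v a x"
  have h: "\<forall>a. radial_smooth (?h a)" using u v by (auto intro: radial_smooth_intros)
  have c: "continuous_on S3 (\<lambda>x. \<Sum>a\<in>UNIV. ?h a x * cnj (u a x))"
    "continuous_on S3 (\<lambda>x. - 1 * (\<Sum>a\<in>UNIV. ?h a x * cnj (v a x)))"
    by (intro radial_smooth_continuous_on radial_smooth_intros u[rule_format] v[rule_format])+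
  have "field_inner ?h ?h = sphere_integral (\<lambda>x. (\<Sum>a\<in>UNIV. ?h a x * cnj (u a x)) + - 1 * (\<Sum>a\<in>UNIV. ?h a x * cnj (v a x)))"
    by (simp add: field_inner_def algebra_simps sum_subtractf sum.distrib)
  also have "\<dots> = field_inner ?h u + - 1 * field_inner ?h v"
    by (simp only: sphere_integral_add[OF c] sphere_integral_cmult field_inner_def)
  also have "\<dots> = 0"
    using eq[OF form1_smooth[OF h]] by (simp add: L2_inner_1[simplified] h u v)
  finally show "u a x = v a x" using field_inner_eq_0[OF h _ x, of a] by simp
qed

lemma field_inner_gradient:
  assumes f: "radial_smooth f" and u: "\<forall>a. radial_smooth (u a)"
  shows "field_inner (\<lambda>a. frame_deriv a f) u = sphere_integral (\<lambda>x. f x * cnj (- frame_div u x))"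
  unfolding field_inner_def
proof (rule sphere_integral_divergence[where h = "\<lambda>a x. f x * cnj (u a x)"])
  show "continuous_on S3 (\<lambda>x. f x * cnj (- frame_div u x))"
    by (intro radial_smooth_continuous_on radial_smooth_mult radial_smooth_cnj radial_smooth_minus
        radial_smooth_frame_div f u)
  show "radial_smooth (\<lambda>x. f x * cnj (u a x))" for a
    by (intro radial_smooth_mult radial_smooth_cnj f u[rule_format])
  show "(\<Sum>a\<in>UNIV. frame_deriv a f x * cnj (u a x)) =
     f x * cnj (- frame_div u x) + (\<Sum>a\<in>UNIV. frame_deriv a (\<lambda>x. f x * cnj (u a x)) x)" if "x \<in> S3" for x
    using f u that
    by (simp add: frame_div_def sum_3 frame_deriv_mult frame_deriv_cnj radial_smooth_cnj algebra_simps del: mem_sphere)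
qed

lemma codiff_form1:
  assumes u: "\<forall>a. radial_smooth (u a)"
  shows "codiff 1 (form1 u) = form0 (\<lambda>x. - frame_div u x)"
proof -
  have s: "radial_smooth (\<lambda>x. - frame_div u x)"
    using radial_smooth_frame_div[OF u] by (intro radial_smooth_intros)
  have adj: "L2_inner (Suc 0) (ext_deriv \<phi>) (form1 u) = L2_inner 0 \<phi> (form0 (\<lambda>x. - frame_div u x))"
    if \<phi>: "\<phi> \<in> smooth_forms 0" for \<phi>
  proof -
    obtain f where f: "radial_smooth f" "\<phi> = form0 f" using smooth_forms_0E[OF \<phi>] by blast
    have df: "\<forall>a. radial_smooth (frame_deriv a f)" using f by (auto intro: radial_smooth_intros)
    have "field_inner (\<lambda>a. frame_deriv a f) u = sphere_integral (\<lambda>x. f x * cnj (- frame_div u x))"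
      by (rule field_inner_gradient[OF f(1) u])
    then show ?thesis
      by (simp add: f ext_deriv_form0 L2_inner_0 L2_inner_1[simplified] df s u)
  qed
  have "codiff (Suc 0) (form1 u) = form0 (\<lambda>x. - frame_div u x)"
    unfolding codiff.simps
  proof (rule the_equality)
    fix \<eta> assume \<eta>: "\<eta> \<in> smooth_forms 0 \<and> (\<forall>\<phi>\<in>smooth_forms 0. L2_inner (Suc 0) (ext_deriv \<phi>) (form1 u) = L2_inner 0 \<phi> \<eta>)"
    then obtain g where g: "radial_smooth g" "\<eta> = form0 g" using smooth_forms_0E by blast
    show "\<eta> = form0 (\<lambda>x. - frame_div u x)"
      unfolding g(2) by (rule L2_0_unique[OF g(1) s]) (use \<eta> adj g in metis)
  qed (use adj form0_smooth[OF s] in auto)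
  then show ?thesis by simp
qed

text \<open>Symmetry of the curl up to the divergence of the cross product of \<open>u\<close> and \<open>cnj w\<close>.\<close>

lemma frame_curl_leibniz:
  assumes u: "\<forall>a. radial_smooth (u a)" and w: "\<forall>a. radial_smooth (w a)" and x: "x \<in> S3"
  shows "(\<Sum>a\<in>UNIV. frame_curl u a x * cnj (w a x)) = (\<Sum>a\<in>UNIV. u a x * cnj (frame_curl w a x))
     + (\<Sum>a\<in>UNIV. frame_deriv a (\<lambda>x. u (a + 1) x * cnj (w (a + 2) x) - u (a + 2) x * cnj (w (a + 1) x)) x)"
proof -
  have s: "radial_smooth (\<lambda>x. u a x * cnj (w b x))" for a b
    by (intro radial_smooth_mult radial_smooth_cnj u[rule_format] w[rule_format])
  have leibniz: "frame_deriv c (\<lambda>x. u a x * cnj (w b x) - u a' x * cnj (w b' x)) x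
      = u a x * cnj (frame_deriv c (w b) x) + frame_deriv c (u a) x * cnj (w b x)
        - (u a' x * cnj (frame_deriv c (w b') x) + frame_deriv c (u a') x * cnj (w b' x))" for a b a' b' c
    using u w x
    by (simp add: frame_deriv_diff s frame_deriv_mult frame_deriv_cnj radial_smooth_cnj del: mem_sphere)
  show ?thesis
    unfolding leibniz by (simp add: frame_curl_def sum_3 cyclic_index algebra_simps del: one_add_one)
qed

lemma field_inner_curl:
  assumes u: "\<forall>a. radial_smooth (u a)" and w: "\<forall>a. radial_smooth (w a)"
  shows "field_inner (frame_curl u) w = field_inner u (frame_curl w)"
  unfolding field_inner_def
proof (rule sphere_integral_divergence[OF _ _ frame_curl_leibniz[OF u w]])
  show "continuous_on S3 (\<lambda>x. \<Sum>a\<in>UNIV. u a x * cnj (frame_curl w a x))"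
    by (intro radial_smooth_continuous_on radial_smooth_sum radial_smooth_mult radial_smooth_cnj
        radial_smooth_frame_curl u[rule_format] w)
  show "radial_smooth (\<lambda>x. u (a + 1) x * cnj (w (a + 2) x) - u (a + 2) x * cnj (w (a + 1) x))" for a
    by (intro radial_smooth_diff radial_smooth_mult radial_smooth_cnj u[rule_format] w[rule_format])
qed

lemma codiff_form2:
  assumes w: "\<forall>a. radial_smooth (w a)"
  shows "codiff 2 (form2 w) = form1 (frame_curl w)"
proof -
  have s: "\<forall>a. radial_smooth (frame_curl w a)" using radial_smooth_frame_curl[OF w] by blast
  have adj: "L2_inner (Suc 1) (ext_deriv \<phi>) (form2 w) = L2_inner 1 \<phi> (form1 (frame_curl w))"
    if \<phi>: "\<phi> \<in> smooth_forms 1" for \<phi>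
  proof -
    obtain u where u: "\<forall>a. radial_smooth (u a)" "\<phi> = form1 u" using smooth_forms_1E[OF \<phi>] by blast
    have c: "\<forall>a. radial_smooth (frame_curl u a)" using radial_smooth_frame_curl[OF u(1)] by blast
    show ?thesis
      using L2_inner_2[OF c w] L2_inner_1[OF u(1) s] field_inner_curl[OF u(1) w]
      by (simp add: u(2) ext_deriv_form1[OF u(1)] numeral_2_eq_2)
  qed
  have "codiff (Suc 1) (form2 w) = form1 (frame_curl w)"
    unfolding codiff.simps
  proof (rule the_equality)
    fix \<eta> assume \<eta>: "\<eta> \<in> smooth_forms 1 \<and> (\<forall>\<phi>\<in>smooth_forms 1. L2_inner (Suc 1) (ext_deriv \<phi>) (form2 w) = L2_inner 1 \<phi> \<eta>)"
    then obtain v where v: "\<forall>a. radial_smooth (v a)" "\<eta> = form1 v" using smooth_forms_1E by blast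
    show "\<eta> = form1 (frame_curl w)"
      unfolding v(2) by (rule L2_1_unique[OF v(1) s]) (use \<eta> adj v in metis)
  qed (use adj form1_smooth[OF s] in auto)
  then show ?thesis by (simp add: numeral_2_eq_2)
qed

section \<open>The magnetic Laplacian of a multiple of the Hopf field\<close>

text \<open>Here \<open>mag_grad\<close>, \<open>mag_div\<close> and \<open>mag_curl\<close> are the gradient, divergence and curl with the derivative
  \<open>E\<^sub>1\<close> replaced by \<open>E\<^sub>1 + \<i> t\<close>, which is again skew for the L2 product.\<close>

definition mag_grad :: "real \<Rightarrow> (real^4 \<Rightarrow> complex) \<Rightarrow> 3 \<Rightarrow> real^4 \<Rightarrow> complex" where
  "mag_grad t f a x = frame_deriv a f x + (if a = 1 then \<i> * t * f x else 0)"

definition mag_div :: "real \<Rightarrow> (3 \<Rightarrow> real^4 \<Rightarrow> complex) \<Rightarrow> real^4 \<Rightarrow> complex" where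
  "mag_div t u x = frame_div u x + \<i> * t * u 1 x"

text \<open>The cross product of \<open>Y2\<close>, whose components are \<open>(1, 0, 0)\<close>, with \<open>u\<close>. It represents both the wedge
  product of the dual of \<open>Y2\<close> with a 1-form and, up to sign, the contraction of a 2-form with \<open>Y2\<close>.\<close>

definition hopf_cross :: "(3 \<Rightarrow> real^4 \<Rightarrow> complex) \<Rightarrow> 3 \<Rightarrow> real^4 \<Rightarrow> complex" where
  "hopf_cross u a x = (if a = 1 then 0 else if a = 2 then - u 3 x else u 2 x)"

definition mag_curl :: "real \<Rightarrow> (3 \<Rightarrow> real^4 \<Rightarrow> complex) \<Rightarrow> 3 \<Rightarrow> real^4 \<Rightarrow> complex" where
  "mag_curl t u a x = frame_curl u a x + \<i> * t * hopf_cross u a x"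

definition mag_lap :: "real \<Rightarrow> (3 \<Rightarrow> real^4 \<Rightarrow> complex) \<Rightarrow> 3 \<Rightarrow> real^4 \<Rightarrow> complex" where
  "mag_lap t u a x = mag_curl t (mag_curl t u) a x - mag_grad t (mag_div t u) a x"

lemma radial_smooth_hopf_cross: "\<forall>a. radial_smooth (u a) \<Longrightarrow> radial_smooth (hopf_cross u a)"
  unfolding hopf_cross_def
  by (cases "a = 1"; cases "a = 2") (simp_all add: radial_smooth_minus)

lemma radial_smooth_mag_grad: "radial_smooth f \<Longrightarrow> radial_smooth (mag_grad t f a)"
  unfolding mag_grad_def
  by (cases "a = 1") (simp_all add: radial_smooth_add radial_smooth_mult radial_smooth_frame_deriv)

lemma radial_smooth_mag_div: "\<forall>a. radial_smooth (u a) \<Longrightarrow> radial_smooth (mag_div t u)"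
  unfolding mag_div_def
  by (simp add: radial_smooth_add radial_smooth_mult radial_smooth_frame_div)

lemma radial_smooth_mag_curl: "\<forall>a. radial_smooth (u a) \<Longrightarrow> \<forall>a. radial_smooth (mag_curl t u a)"
  unfolding mag_curl_def
  by (simp add: radial_smooth_add radial_smooth_mult radial_smooth_frame_curl radial_smooth_hopf_cross)

lemma Y2_inner_frame: "x \<in> S3 \<Longrightarrow> Y2 x \<bullet> hopf_frame a x = (if a = 1 then 1 else 0)"
  using hopf_frame_orthonormal[of 1 x a] by (simp add: hopf_frame_1 S3_inner_self del: mem_sphere)

lemma wedge_field_form0:
  "wedge_field (\<lambda>x. t *\<^sub>R Y2 x) (form0 f) = form1 (\<lambda>a x. if a = 1 then t * f x else 0)"
proof (rule cform_eqI[where p = 1])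
  fix x :: "real^4" and vs
  assume "\<not> (x \<in> S3 \<and> length vs = 1 \<and> set vs \<subseteq> tangent_space x)"
  then show "wedge_field (\<lambda>x. t *\<^sub>R Y2 x) (form0 f) x vs = 0
      \<and> form1 (\<lambda>a x. if a = 1 then complex_of_real t * f x else 0) x vs = 0"
    by (auto simp: wedge_field_def form0_def form1_def length_drop_nth intro!: sum.neutral)
qed (auto simp: length_1_conv wedge_field_def form0_def form1_def drop_nth_simps sum_3 hopf_frame_1 inner_commute)

lemma wedge_field_form1:
  "wedge_field (\<lambda>x. t *\<^sub>R Y2 x) (form1 u) = form2 (\<lambda>a x. t * hopf_cross u a x)"
proof (rule cform_eqI[where p = 2])
  fix x :: "real^4" and vs
  assume "\<not> (x \<in> S3 \<and> length vs = 2 \<and> set vs \<subseteq> tangent_space x)"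
  then show "wedge_field (\<lambda>x. t *\<^sub>R Y2 x) (form1 u) x vs = 0
      \<and> form2 (\<lambda>a x. complex_of_real t * hopf_cross u a x) x vs = 0"
    by (auto simp: wedge_field_def form1_def form2_def length_drop_nth intro!: sum.neutral)
next
  fix x :: "real^4" and vs
  assume x: "x \<in> S3" and "length vs = 2" and t: "set vs \<subseteq> tangent_space x"
  then obtain v w where "vs = [v, w]" by (auto simp: length_2_conv)
  with x t show "wedge_field (\<lambda>x. t *\<^sub>R Y2 x) (form1 u) x vs = form2 (\<lambda>a x. t * hopf_cross u a x) x vs"
    by (simp add: wedge_field_def form1_def form2_def drop_nth_simps sum_3 hopf_frame_1[symmetric] inner_commute
        numeral_2_eq_2 lessThan_Suc coframe_wedge_def cyclic_index[simplified numeral_2_eq_2] hopf_cross_def algebra_simps)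
qed

lemma contract_field_form1:
  "contract_field (\<lambda>x. t *\<^sub>R Y2 x) (form1 u) = form0 (\<lambda>x. t * u 1 x)"
proof (rule cform_eqI[where p = 0])
  fix x :: "real^4" and vs :: "(real^4) list"
  assume "x \<in> S3" "length vs = 0"
  then show "contract_field (\<lambda>x. t *\<^sub>R Y2 x) (form1 u) x vs = form0 (\<lambda>x. t * u 1 x) x vs"
    using Y2_unit_tangent(1)[of x]
    by (simp add: contract_field_def form0_def form1_def sum_3 Y2_inner_frame tangent_space_def)
qed (auto simp: contract_field_def form0_def form1_def)

lemma contract_field_form2:
  "contract_field (\<lambda>x. t *\<^sub>R Y2 x) (form2 w) = form1 (\<lambda>a x. - (t * hopf_cross w a x))"
proof (rule cform_eqI[where p = 1])
  fix x :: "real^4" and vs :: "(real^4) list"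
  assume x: "x \<in> S3" and "length vs = 1" and t: "set vs \<subseteq> tangent_space x"
  then obtain v where "vs = [v]" by (auto simp: length_1_conv)
  with x t show "contract_field (\<lambda>x. t *\<^sub>R Y2 x) (form2 w) x vs = form1 (\<lambda>a x. - (t * hopf_cross w a x)) x vs"
    using Y2_unit_tangent(1)[of x]
    by (simp add: contract_field_def form1_def form2_def sum_3 Y2_inner_frame coframe_wedge_def hopf_cross_def
        cyclic_index tangent_space_def algebra_simps del: one_add_one)
qed (auto simp: contract_field_def form1_def form2_def)

lemma form0_add: "form0 f x vs + c * form0 g x vs = form0 (\<lambda>x. f x + c * g x) x vs"
  by (simp add: form0_def)

lemma form1_add: "form1 u x vs + c * form1 v x vs = form1 (\<lambda>a x. u a x + c * v a x) x vs"
  by (simp add: form1_def sum_distrib_left sum.distrib algebra_simps)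

lemma form2_add: "form2 u x vs + c * form2 v x vs = form2 (\<lambda>a x. u a x + c * v a x) x vs"
  by (simp add: form2_def sum_distrib_left sum.distrib algebra_simps)

lemma form1_scale: "c * form1 u x vs = form1 (\<lambda>a x. c * u a x) x vs"
  by (simp add: form1_def sum_distrib_left algebra_simps)

lemma magnetic_deriv_form0:
  "radial_smooth f \<Longrightarrow> magnetic_deriv (\<lambda>x. t *\<^sub>R Y2 x) (form0 f) = form1 (mag_grad t f)"
  unfolding magnetic_deriv_def wedge_field_form0
  by (simp add: ext_deriv_form0 form1_add) (auto simp: mag_grad_def fun_eq_iff intro!: form1_cong[THEN fun_cong, THEN fun_cong])

lemma magnetic_deriv_form1:
  "\<forall>a. radial_smooth (u a) \<Longrightarrow> magnetic_deriv (\<lambda>x. t *\<^sub>R Y2 x) (form1 u) = form2 (mag_curl t u)"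
  unfolding magnetic_deriv_def wedge_field_form1
  by (simp add: ext_deriv_form1 form2_add) (auto simp: mag_curl_def fun_eq_iff intro!: form2_cong[THEN fun_cong, THEN fun_cong])

lemma magnetic_codiff_form1:
  "\<forall>a. radial_smooth (u a) \<Longrightarrow> magnetic_codiff (\<lambda>x. t *\<^sub>R Y2 x) 1 (form1 u) = form0 (\<lambda>x. - mag_div t u x)"
  unfolding magnetic_codiff_def contract_field_form1
  using form0_add[of "\<lambda>x. - frame_div u x" _ _ "-\<i>" "\<lambda>x. t * u 1 x"]
  by (simp add: codiff_form1[simplified]) (auto simp: mag_div_def fun_eq_iff algebra_simps intro!: form0_cong[THEN fun_cong, THEN fun_cong])

lemma magnetic_codiff_form2:
  "\<forall>a. radial_smooth (w a) \<Longrightarrow> magnetic_codiff (\<lambda>x. t *\<^sub>R Y2 x) 2 (form2 w) = form1 (mag_curl t w)"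
  unfolding magnetic_codiff_def contract_field_form2
  using form1_add[of "frame_curl w" _ _ "-\<i>" "\<lambda>a x. - (t * hopf_cross w a x)"]
  by (simp add: codiff_form2) (auto simp: mag_curl_def fun_eq_iff algebra_simps intro!: form1_cong[THEN fun_cong, THEN fun_cong])

lemma mag_grad_minus: "radial_smooth f \<Longrightarrow> x \<in> S3 \<Longrightarrow> mag_grad t (\<lambda>x. - f x) a x = - mag_grad t f a x"
  by (simp add: mag_grad_def frame_deriv_minus del: mem_sphere)

lemma magnetic_laplacian_form1:
  assumes u: "\<forall>a. radial_smooth (u a)"
  shows "magnetic_laplacian (\<lambda>x. t *\<^sub>R Y2 x) 1 (form1 u) = form1 (mag_lap t u)"
proof -
  have d: "radial_smooth (mag_div t u)" "radial_smooth (\<lambda>x. - mag_div t u x)"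
    by (intro radial_smooth_minus radial_smooth_mag_div u)+
  have "magnetic_laplacian (\<lambda>x. t *\<^sub>R Y2 x) 1 (form1 u)
      = (\<lambda>x vs. form1 (mag_grad t (\<lambda>x. - mag_div t u x)) x vs + 1 * form1 (mag_curl t (mag_curl t u)) x vs)"
    unfolding magnetic_laplacian_def
    using magnetic_codiff_form2[OF radial_smooth_mag_curl[OF u]] magnetic_codiff_form1[OF u] magnetic_deriv_form1[OF u]
      magnetic_deriv_form0[OF d(2)]
    by (simp add: numeral_2_eq_2)
  also have "\<dots> = form1 (\<lambda>a x. mag_grad t (\<lambda>x. - mag_div t u x) a x + 1 * mag_curl t (mag_curl t u) a x)"
    unfolding form1_add ..
  also have "\<dots> = form1 (mag_lap t u)"
    by (rule form1_cong) (simp add: mag_lap_def mag_grad_minus[OF d(1)] del: mem_sphere)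
  finally show ?thesis .
qed

text \<open>The Hodge Laplacian is the magnetic one with zero potential.\<close>

lemma hodge_laplacian_form1:
  assumes u: "\<forall>a. radial_smooth (u a)"
  shows "hodge_laplacian 1 (form1 u) = form1 (mag_lap 0 u)"
proof -
  have "hodge_laplacian 1 (form1 u) = magnetic_laplacian (\<lambda>x. 0 *\<^sub>R Y2 x) 1 (form1 u)"
  proof -
    have d0: "magnetic_deriv (\<lambda>x. 0 *\<^sub>R Y2 x) \<omega> = ext_deriv \<omega>" for \<omega>
      by (simp add: magnetic_deriv_def wedge_field_def fun_eq_iff)
    have c1: "magnetic_codiff (\<lambda>x. 0 *\<^sub>R Y2 x) 1 (form1 u) = codiff 1 (form1 u)"
      unfolding magnetic_codiff_def contract_field_form1 by (simp add: form0_def)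
    have c2: "magnetic_codiff (\<lambda>x. 0 *\<^sub>R Y2 x) (Suc 1) (form2 w) = codiff (Suc 1) (form2 w)" for w
      unfolding magnetic_codiff_def contract_field_form2 by (auto simp: form1_def fun_eq_iff simp del: codiff.simps)
    show ?thesis
      unfolding hodge_laplacian_def magnetic_laplacian_def d0 c1 unfolding ext_deriv_form1[OF u] c2 ..
  qed
  then show ?thesis by (simp only: magnetic_laplacian_form1[OF u])
qed

definition mag_spectrum :: "real \<Rightarrow> real set" where
  "mag_spectrum t = {c. \<exists>u. (\<forall>a. radial_smooth (u a)) \<and> (\<exists>a. \<exists>x\<in>S3. u a x \<noteq> 0) \<and>
     (\<forall>a. \<forall>x\<in>S3. mag_lap t u a x = of_real c * u a x)}"

lemma eigenvalues_eq_mag_spectrum: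
  assumes L: "\<And>u. \<forall>a. radial_smooth (u a) \<Longrightarrow> L (form1 u) = form1 (mag_lap t u)"
  shows "eigenvalues 1 L = mag_spectrum t"
proof -
  have zero: "(\<lambda>x vs. 0) = form1 (\<lambda>a x. 0)" by (simp add: form1_def fun_eq_iff)
  have conv: "(form1 u \<noteq> (\<lambda>x vs. 0) \<and> L (form1 u) = (\<lambda>x vs. of_real c * form1 u x vs)) \<longleftrightarrow>
      (\<exists>a. \<exists>x\<in>S3. u a x \<noteq> 0) \<and> (\<forall>a. \<forall>x\<in>S3. mag_lap t u a x = of_real c * u a x)"
    if "\<forall>a. radial_smooth (u a)" for u :: "3 \<Rightarrow> real^4 \<Rightarrow> complex" and c
    unfolding L[OF that] form1_scale zero form1_eq_iff by blast
  show ?thesis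
  proof (intro set_eqI iffI)
    fix c assume "c \<in> eigenvalues 1 L"
    then obtain \<omega> where \<omega>: "\<omega> \<in> smooth_forms 1" "\<omega> \<noteq> (\<lambda>x vs. 0)" "L \<omega> = (\<lambda>x vs. of_real c * \<omega> x vs)"
      by (auto simp: eigenvalues_def)
    obtain u where u: "\<forall>a. radial_smooth (u a)" "\<omega> = form1 u" using smooth_forms_1E[OF \<omega>(1)] by blast
    then show "c \<in> mag_spectrum t" using \<omega> conv[OF u(1)] unfolding mag_spectrum_def by blast
  next
    fix c assume "c \<in> mag_spectrum t"
    then obtain u where u: "\<forall>a. radial_smooth (u a)" "\<exists>a. \<exists>x\<in>S3. u a x \<noteq> 0"
      "\<forall>a. \<forall>x\<in>S3. mag_lap t u a x = of_real c * u a x" unfolding mag_spectrum_def by blast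
    then have "form1 u \<in> smooth_forms 1"
      "form1 u \<noteq> (\<lambda>x vs. 0) \<and> L (form1 u) = (\<lambda>x vs. of_real c * form1 u x vs)"
      using form1_smooth conv[OF u(1)] by blast+
    then show "c \<in> eigenvalues 1 L" unfolding eigenvalues_def by blast
  qed
qed

lemma eigenvalues_magnetic_laplacian:
  "eigenvalues 1 (magnetic_laplacian (\<lambda>x. t *\<^sub>R Y2 x) 1) = mag_spectrum t"
  by (rule eigenvalues_eq_mag_spectrum) (rule magnetic_laplacian_form1)

lemma eigenvalues_hodge_laplacian: "eigenvalues 1 (hodge_laplacian 1) = mag_spectrum 0"
  by (rule eigenvalues_eq_mag_spectrum) (rule hodge_laplacian_form1)

section \<open>Energy identities\<close>

lemma field_inner_mag_curl:
  assumes u: "\<forall>a. radial_smooth (u a)" and w: "\<forall>a. radial_smooth (w a)"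
  shows "field_inner (mag_curl t u) w = field_inner u (mag_curl t w)"
proof -
  let ?B = "\<lambda>x. \<i> * t * (u 2 x * cnj (w 3 x) - u 3 x * cnj (w 2 x))"
  have B: "continuous_on S3 ?B"
    by (intro radial_smooth_continuous_on radial_smooth_diff radial_smooth_mult radial_smooth_cnj
        radial_smooth_const u[rule_format] w[rule_format])
  have A: "continuous_on S3 (\<lambda>x. \<Sum>a\<in>UNIV. frame_curl u a x * cnj (w a x))"
    "continuous_on S3 (\<lambda>x. \<Sum>a\<in>UNIV. u a x * cnj (frame_curl w a x))"
    by (intro radial_smooth_continuous_on radial_smooth_sum radial_smooth_mult radial_smooth_cnj
        radial_smooth_frame_curl u w u[rule_format] w[rule_format])+
  have "field_inner (mag_curl t u) w
      = sphere_integral (\<lambda>x. (\<Sum>a\<in>UNIV. frame_curl u a x * cnj (w a x)) + ?B x)"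
    unfolding field_inner_def by (simp add: mag_curl_def hopf_cross_def sum_3 algebra_simps)
  also have "\<dots> = sphere_integral (\<lambda>x. (\<Sum>a\<in>UNIV. u a x * cnj (frame_curl w a x)) + ?B x)"
    using field_inner_curl[OF u w] by (simp only: sphere_integral_add[OF A(1) B] sphere_integral_add[OF A(2) B] field_inner_def)
  also have "\<dots> = field_inner u (mag_curl t w)"
    unfolding field_inner_def by (simp add: mag_curl_def hopf_cross_def sum_3 algebra_simps)
  finally show ?thesis .
qed

lemma field_inner_mag_grad:
  assumes f: "radial_smooth f" and u: "\<forall>a. radial_smooth (u a)"
  shows "field_inner (mag_grad t f) u = - sphere_integral (\<lambda>x. f x * cnj (mag_div t u x))"
proof -
  let ?B = "\<lambda>x. \<i> * t * (f x * cnj (u 1 x))"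
  have B: "continuous_on S3 ?B"
    by (intro radial_smooth_continuous_on radial_smooth_mult radial_smooth_cnj radial_smooth_const f u[rule_format])
  have A: "continuous_on S3 (\<lambda>x. \<Sum>a\<in>UNIV. frame_deriv a f x * cnj (u a x))"
    "continuous_on S3 (\<lambda>x. f x * cnj (- frame_div u x))"
    by (intro radial_smooth_continuous_on radial_smooth_sum radial_smooth_mult radial_smooth_cnj
        radial_smooth_frame_deriv radial_smooth_minus radial_smooth_frame_div f u u[rule_format])+
  have "field_inner (mag_grad t f) u
      = sphere_integral (\<lambda>x. (\<Sum>a\<in>UNIV. frame_deriv a f x * cnj (u a x)) + ?B x)"
    unfolding field_inner_def by (simp add: mag_grad_def sum_3 algebra_simps)
  also have "\<dots> = sphere_integral (\<lambda>x. f x * cnj (- frame_div u x) + ?B x)"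
    using field_inner_gradient[OF f u] by (simp only: sphere_integral_add[OF A(1) B] sphere_integral_add[OF A(2) B] field_inner_def)
  also have "\<dots> = sphere_integral (\<lambda>x. - 1 * (f x * cnj (mag_div t u x)))"
    by (simp add: mag_div_def algebra_simps)
  finally show ?thesis by (simp only: sphere_integral_cmult) simp
qed

text \<open>Integration by parts: the curl is symmetric, and the divergence is minus the adjoint of the gradient.\<close>

lemma mag_energy:
  assumes u: "\<forall>a. radial_smooth (u a)"
  shows "field_inner (mag_lap t u) u = sphere_integral (\<lambda>x. mag_div t u x * cnj (mag_div t u x))
     + field_inner (mag_curl t u) (mag_curl t u)"
proof -
  note c = radial_smooth_mag_curl[OF u, of t] and d = radial_smooth_mag_div[OF u, of t]
  have A: "continuous_on S3 (\<lambda>x. \<Sum>a\<in>UNIV. mag_curl t (mag_curl t u) a x * cnj (u a x))"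
    "continuous_on S3 (\<lambda>x. - 1 * (\<Sum>a\<in>UNIV. mag_grad t (mag_div t u) a x * cnj (u a x)))"
    by (intro radial_smooth_continuous_on radial_smooth_sum radial_smooth_mult radial_smooth_cnj radial_smooth_const
        radial_smooth_mag_curl[OF c, THEN spec] radial_smooth_mag_grad d u[rule_format])+
  have "field_inner (mag_lap t u) u = sphere_integral (\<lambda>x. (\<Sum>a\<in>UNIV. mag_curl t (mag_curl t u) a x * cnj (u a x))
      + - 1 * (\<Sum>a\<in>UNIV. mag_grad t (mag_div t u) a x * cnj (u a x)))"
    unfolding field_inner_def by (simp add: mag_lap_def sum_3 algebra_simps)
  also have "\<dots> = field_inner (mag_curl t (mag_curl t u)) u + - 1 * field_inner (mag_grad t (mag_div t u)) u"
    by (simp only: sphere_integral_add[OF A] sphere_integral_cmult field_inner_def)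
  finally show ?thesis
    by (simp add: field_inner_mag_curl[OF c u] field_inner_mag_grad[OF d u])
qed

lemma field_inner_self:
  "field_inner u u = of_real (Re (field_inner u u))" "0 \<le> Re (field_inner u u)"
proof -
  have eq: "field_inner u u = sphere_integral (\<lambda>x. of_real (\<Sum>a\<in>UNIV. (cmod (u a x))\<^sup>2))"
    unfolding field_inner_def by (simp only: of_real_sum complex_norm_square)
  show "field_inner u u = of_real (Re (field_inner u u))"
    unfolding eq sphere_integral_of_real by simp
  show "0 \<le> Re (field_inner u u)"
    unfolding eq by (rule sphere_integral_of_real_nonneg) (simp add: sum_nonneg)
qed

lemma sphere_integral_norm_nonneg: "0 \<le> Re (sphere_integral (\<lambda>x. f x * cnj (f x)))"
  using sphere_integral_of_real_nonneg[of "\<lambda>x. (cmod (f x))\<^sup>2"] by (simp only: complex_norm_square) simp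

lemma eigenvalue_energy:
  assumes u: "\<forall>a. radial_smooth (u a)" and ne: "\<exists>a. \<exists>x\<in>S3. u a x \<noteq> 0"
    and eig: "\<forall>a. \<forall>x\<in>S3. mag_lap t u a x = of_real c * u a x"
  shows "0 < Re (field_inner u u)"
    and "c * Re (field_inner u u) = Re (sphere_integral (\<lambda>x. mag_div t u x * cnj (mag_div t u x)))
       + Re (field_inner (mag_curl t u) (mag_curl t u))"
proof -
  have "field_inner u u \<noteq> 0" using field_inner_eq_0[OF u] ne by blast
  then show "0 < Re (field_inner u u)" using field_inner_self[of u] by (metis less_eq_real_def of_real_0)
  have "field_inner (mag_lap t u) u = sphere_integral (\<lambda>x. of_real c * (\<Sum>a\<in>UNIV. u a x * cnj (u a x)))"
    unfolding field_inner_def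
  proof (rule sphere_integral_cong[symmetric])
    show "continuous_on S3 (\<lambda>x. of_real c * (\<Sum>a\<in>UNIV. u a x * cnj (u a x)))"
      by (intro radial_smooth_continuous_on radial_smooth_sum radial_smooth_mult radial_smooth_cnj
          radial_smooth_const u[rule_format])
  qed (use eig in \<open>simp add: sum_distrib_left mult.assoc del: mem_sphere\<close>)
  then have "field_inner (mag_lap t u) u = of_real c * field_inner u u"
    unfolding sphere_integral_cmult field_inner_def .
  from arg_cong[OF this, of Re] show "c * Re (field_inner u u) = Re (sphere_integral (\<lambda>x. mag_div t u x * cnj (mag_div t u x)))
       + Re (field_inner (mag_curl t u) (mag_curl t u))"
    unfolding mag_energy[OF u] by simp
qed

lemma eigenvalue_nonneg:
  assumes "\<forall>a. radial_smooth (u a)" "\<exists>a. \<exists>x\<in>S3. u a x \<noteq> 0"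
    and "\<forall>a. \<forall>x\<in>S3. mag_lap t u a x = of_real c * u a x"
  shows "0 \<le> c"
proof -
  have "0 \<le> c * Re (field_inner u u)"
    unfolding eigenvalue_energy(2)[OF assms]
    by (intro add_nonneg_nonneg sphere_integral_norm_nonneg field_inner_self)
  then show ?thesis using eigenvalue_energy(1)[OF assms] by (simp add: zero_le_mult_iff)
qed

section \<open>The Bochner inequality\<close>

text \<open>The symmetric part of the covariant derivative. Since \<open>\<nabla>\<^bsub>E\<^sub>a\<^esub> E\<^sub>b\<close> is half of \<open>[E\<^sub>a, E\<^sub>b]\<close>, which
  is skew in \<open>a\<close> and \<open>b\<close>, the connection does not contribute to it.\<close>

definition sym_grad :: "(3 \<Rightarrow> real^4 \<Rightarrow> complex) \<Rightarrow> 3 \<Rightarrow> 3 \<Rightarrow> real^4 \<Rightarrow> complex" where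
  "sym_grad u a b x = (frame_deriv a (u b) x + frame_deriv b (u a) x) / 2"

lemma sym_grad_norm:
  "(\<Sum>a\<in>UNIV. \<Sum>b\<in>UNIV. sym_grad u a b x * cnj (sym_grad u a b x))
   = (\<Sum>a\<in>UNIV. frame_curl u a x * cnj (frame_curl u a x)) / 2
     + (\<Sum>a\<in>UNIV. \<Sum>b\<in>UNIV. frame_deriv a (u b) x * cnj (frame_deriv b (u a) x))
     + (\<Sum>a\<in>UNIV. u a x * cnj (frame_curl u a x)) + (\<Sum>a\<in>UNIV. frame_curl u a x * cnj (u a x))
     + 2 * (\<Sum>a\<in>UNIV. u a x * cnj (u a x))"
  by (simp add: sym_grad_def frame_curl_def sum_3 cyclic_index field_simps del: one_add_one)

lemma frame_deriv_commutators:
  assumes "radial_smooth f" "x \<in> S3"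
  shows "frame_deriv 1 (frame_deriv 2 f) x = frame_deriv 2 (frame_deriv 1 f) x + 2 * frame_deriv 3 f x"
    "frame_deriv 2 (frame_deriv 3 f) x = frame_deriv 3 (frame_deriv 2 f) x + 2 * frame_deriv 1 f x"
    "frame_deriv 3 (frame_deriv 1 f) x = frame_deriv 1 (frame_deriv 3 f) x + 2 * frame_deriv 2 f x"
  using frame_deriv_commute[OF assms, of 1] frame_deriv_commute[OF assms, of 2] frame_deriv_commute[OF assms, of 3]
  by (simp_all add: cyclic_index del: one_add_one)

definition bochner_field :: "(3 \<Rightarrow> real^4 \<Rightarrow> complex) \<Rightarrow> 3 \<Rightarrow> real^4 \<Rightarrow> complex" where
  "bochner_field u a x = (\<Sum>b\<in>UNIV. u b x * cnj (frame_deriv b (u a) x)) - u a x * cnj (frame_div u x)"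

lemma radial_smooth_bochner_field: "\<forall>a. radial_smooth (u a) \<Longrightarrow> radial_smooth (bochner_field u a)"
  unfolding bochner_field_def
  by (intro radial_smooth_diff radial_smooth_sum radial_smooth_mult radial_smooth_cnj radial_smooth_frame_deriv
      radial_smooth_frame_div) auto

text \<open>Move \<open>E\<^sub>a\<close> off the first factor, exchange it with \<open>E\<^sub>b\<close>, and move \<open>E\<^sub>b\<close> back. The commutators
  are responsible for the curl term and for the term of order zero, in which the Ricci curvature
  of the sphere is hidden.\<close>

lemma bochner_leibniz:
  assumes u: "\<forall>a. radial_smooth (u a)" and x: "x \<in> S3"
  shows "(\<Sum>a\<in>UNIV. \<Sum>b\<in>UNIV. frame_deriv a (u b) x * cnj (frame_deriv b (u a) x))
    = frame_div u x * cnj (frame_div u x) - 2 * (\<Sum>a\<in>UNIV. u a x * cnj (frame_curl u a x))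
      - 4 * (\<Sum>a\<in>UNIV. u a x * cnj (u a x)) + (\<Sum>a\<in>UNIV. frame_deriv a (bochner_field u a) x)"
proof -
  have ru: "radial_smooth (u a)" for a using u by blast
  have rd: "radial_smooth (frame_deriv b (u a))" for a b by (intro radial_smooth_frame_deriv ru)
  have m: "frame_deriv c (\<lambda>x. u b x * cnj (frame_deriv d (u a) x)) x
      = u b x * cnj (frame_deriv c (frame_deriv d (u a)) x) + frame_deriv c (u b) x * cnj (frame_deriv d (u a) x)" for a b c d
    by (simp only: frame_deriv_mult[OF ru radial_smooth_cnj[OF rd] x] frame_deriv_cnj[OF rd x])
  have rm: "radial_smooth (\<lambda>x. u b x * cnj (frame_deriv d (u a) x))" for a b d
    by (intro radial_smooth_mult radial_smooth_cnj ru rd)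
  have rD: "radial_smooth (frame_div u)" by (rule radial_smooth_frame_div[OF u])
  have D: "frame_deriv c (frame_div u) x = frame_deriv c (frame_deriv 1 (u 1)) x + frame_deriv c (frame_deriv 2 (u 2)) x
      + frame_deriv c (frame_deriv 3 (u 3)) x" for c
    unfolding frame_div_def sum_3 by (simp only: frame_deriv_add[OF _ _ x] radial_smooth_add rd)
  have B: "frame_deriv a (bochner_field u a) x = (\<Sum>b\<in>UNIV. u b x * cnj (frame_deriv a (frame_deriv b (u a)) x)
        + frame_deriv a (u b) x * cnj (frame_deriv b (u a) x))
      - (u a x * cnj (frame_deriv a (frame_div u) x) + frame_deriv a (u a) x * cnj (frame_div u x))" for a
    unfolding bochner_field_def sum_3
    by (simp only: frame_deriv_diff[OF _ _ x] frame_deriv_add[OF _ _ x] radial_smooth_add rm m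
        radial_smooth_mult radial_smooth_cnj ru rD frame_deriv_mult[OF _ _ x] frame_deriv_cnj[OF _ x])
  show ?thesis
    unfolding B D
    by (simp add: frame_div_def frame_curl_def sum_3 cyclic_index frame_deriv_commutators[OF ru x] algebra_simps
        del: one_add_one)
qed

lemma cmod_sum_3_le: "(cmod (z1 + z2 + z3))\<^sup>2 \<le> 3 * ((cmod z1)\<^sup>2 + (cmod z2)\<^sup>2 + (cmod z3)\<^sup>2)"
proof -
  have "(cmod (z1 + z2 + z3))\<^sup>2 \<le> (cmod z1 + cmod z2 + cmod z3)\<^sup>2"
    by (intro power_mono norm_triangle_le norm_triangle_ineq order_trans[OF norm_triangle_ineq] add_right_mono) auto
  also have "\<dots> \<le> 3 * ((cmod z1)\<^sup>2 + (cmod z2)\<^sup>2 + (cmod z3)\<^sup>2)"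
    using sum_squares_ge_zero[of "cmod z1 - cmod z2" "cmod z2 - cmod z3"] zero_le_square[of "cmod z1 - cmod z3"]
    by (simp add: power2_eq_square algebra_simps)
  finally show ?thesis .
qed

lemma sym_grad_ge_trace:
  "(cmod (frame_div u x))\<^sup>2 / 3 \<le> (\<Sum>a\<in>UNIV. \<Sum>b\<in>UNIV. (cmod (sym_grad u a b x))\<^sup>2)"
proof -
  have "(cmod (frame_div u x))\<^sup>2 / 3 \<le> (\<Sum>a\<in>UNIV. (cmod (sym_grad u a a x))\<^sup>2)"
    using cmod_sum_3_le[of "sym_grad u 1 1 x" "sym_grad u 2 2 x" "sym_grad u 3 3 x"]
    by (simp add: frame_div_def sym_grad_def sum_3)
  also have "\<dots> \<le> (\<Sum>a\<in>UNIV. \<Sum>b\<in>UNIV. (cmod (sym_grad u a b x))\<^sup>2)"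
    by (intro sum_mono member_le_sum) auto
  finally show ?thesis .
qed

text \<open>Combining \<open>sym_grad_norm\<close> with \<open>bochner_leibniz\<close> and integrating gives the Bochner formula
  \<open>\<parallel>S\<parallel>\<^sup>2 = \<parallel>div u\<parallel>\<^sup>2 + \<parallel>curl u\<parallel>\<^sup>2 / 2 - 2 \<parallel>u\<parallel>\<^sup>2\<close>, where \<open>S\<close> is the symmetrised gradient.
  The trace of \<open>S\<close> is \<open>div u\<close>, so the left-hand side is at least \<open>\<parallel>div u\<parallel>\<^sup>2 / 3\<close>.\<close>

lemma bochner_inequality:
  assumes u: "\<forall>a. radial_smooth (u a)"
  shows "2 * Re (field_inner u u) \<le> 2 / 3 * Re (sphere_integral (\<lambda>x. frame_div u x * cnj (frame_div u x)))
     + 1 / 2 * Re (field_inner (frame_curl u) (frame_curl u))"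
proof -
  have ru: "radial_smooth (u a)" for a using u by blast
  have rd: "radial_smooth (frame_deriv b (u a))" for a b by (intro radial_smooth_frame_deriv ru)
  have rD: "radial_smooth (frame_div u)" by (rule radial_smooth_frame_div[OF u])
  have rC: "radial_smooth (frame_curl u a)" for a by (rule radial_smooth_frame_curl[OF u])
  have rS: "radial_smooth (sym_grad u a b)" for a b
    unfolding sym_grad_def divide_inverse by (intro radial_smooth_mult radial_smooth_add rd radial_smooth_const)
  let ?S = "\<lambda>x. \<Sum>a\<in>UNIV. \<Sum>b\<in>UNIV. sym_grad u a b x * cnj (sym_grad u a b x)"
  let ?D = "\<lambda>x. frame_div u x * cnj (frame_div u x)"
  let ?C = "\<lambda>x. \<Sum>a\<in>UNIV. frame_curl u a x * cnj (frame_curl u a x)"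
  let ?U = "\<lambda>x. \<Sum>a\<in>UNIV. u a x * cnj (u a x)"
  let ?X = "\<lambda>a x. u (a + 1) x * cnj (u (a + 2) x) - u (a + 2) x * cnj (u (a + 1) x)"
  note smooth = radial_smooth_sum radial_smooth_mult radial_smooth_cnj radial_smooth_diff radial_smooth_add
    radial_smooth_const ru rD rC rS
  have c: "continuous_on S3 ?S" "continuous_on S3 ?D" "continuous_on S3 (\<lambda>x. 1 / 2 * ?C x)"
    "continuous_on S3 (\<lambda>x. - 2 * ?U x)" "continuous_on S3 (\<lambda>x. - (1 / 3) * ?D x)"
    "continuous_on S3 (\<lambda>x. ?D x + 1 / 2 * ?C x)" "continuous_on S3 (\<lambda>x. ?D x + 1 / 2 * ?C x + - 2 * ?U x)"
    by (intro radial_smooth_continuous_on smooth)+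
  have "sphere_integral ?S = sphere_integral (\<lambda>x. ?D x + 1 / 2 * ?C x + - 2 * ?U x)"
  \<comment> \<open>The field \<open>?X\<close> accounts for the two mixed curl terms in \<open>sym_grad_norm\<close>, which are complex conjugates
    of each other and agree only up to a divergence.\<close>
  proof (rule sphere_integral_divergence[where h = "\<lambda>a x. bochner_field u a x + ?X a x"])
    show "radial_smooth (\<lambda>x. bochner_field u a x + ?X a x)" for a
      by (intro radial_smooth_add radial_smooth_bochner_field u smooth)
    show "?S x = ?D x + 1 / 2 * ?C x + - 2 * ?U x + (\<Sum>a\<in>UNIV. frame_deriv a (\<lambda>x. bochner_field u a x + ?X a x) x)"
      if x: "x \<in> S3" for x
    proof -
      have "frame_deriv a (\<lambda>x. bochner_field u a x + ?X a x) x = frame_deriv a (bochner_field u a) x + frame_deriv a (?X a) x" for a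
        by (intro frame_deriv_add radial_smooth_bochner_field u x smooth)
      then show ?thesis
        unfolding sym_grad_norm bochner_leibniz[OF u x] frame_curl_leibniz[OF u u x]
        by (simp add: sum.distrib)
    qed
  qed (fact c)
  also have "\<dots> = sphere_integral ?D + 1 / 2 * sphere_integral ?C + - 2 * sphere_integral ?U"
    by (simp only: sphere_integral_add c sphere_integral_cmult)
  finally have S: "sphere_integral ?S = sphere_integral ?D + 1 / 2 * field_inner (frame_curl u) (frame_curl u)
      - 2 * field_inner u u"
    by (simp add: field_inner_def)
  have "0 \<le> Re (sphere_integral (\<lambda>x. of_real ((\<Sum>a\<in>UNIV. \<Sum>b\<in>UNIV. (cmod (sym_grad u a b x))\<^sup>2) - (cmod (frame_div u x))\<^sup>2 / 3)))"
    by (rule sphere_integral_of_real_nonneg) (simp only: diff_ge_0_iff_ge sym_grad_ge_trace)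
  also have "(\<lambda>x. complex_of_real ((\<Sum>a\<in>UNIV. \<Sum>b\<in>UNIV. (cmod (sym_grad u a b x))\<^sup>2) - (cmod (frame_div u x))\<^sup>2 / 3))
      = (\<lambda>x. ?S x + - (1 / 3) * ?D x)"
    by (simp only: of_real_diff of_real_sum of_real_divide complex_norm_square) simp
  also have "sphere_integral \<dots> = sphere_integral ?S + - (1 / 3) * sphere_integral ?D"
    by (simp only: sphere_integral_add c sphere_integral_cmult)
  finally show ?thesis unfolding S by simp
qed

text \<open>With \<open>d = \<parallel>div u\<parallel>\<^sup>2\<close> and \<open>k = \<parallel>curl u\<parallel>\<^sup>2\<close>, the energy identity says \<open>c \<parallel>u\<parallel>\<^sup>2 = d + k\<close>, and
  the Bochner inequality gives \<open>2 \<parallel>u\<parallel>\<^sup>2 \<le> 2/3 d + 1/2 k \<le> 2/3 (d + k)\<close>.\<close>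

lemma hodge_eigenvalue_ge_3:
  assumes u: "\<forall>a. radial_smooth (u a)" and ne: "\<exists>a. \<exists>x\<in>S3. u a x \<noteq> 0"
    and eig: "\<forall>a. \<forall>x\<in>S3. mag_lap 0 u a x = of_real c * u a x"
  shows "3 \<le> c"
proof -
  have 0: "mag_div 0 u = frame_div u" "mag_curl 0 u = frame_curl u"
    by (simp_all add: mag_div_def mag_curl_def fun_eq_iff)
  have "3 * Re (field_inner u u) \<le> c * Re (field_inner u u)"
    using bochner_inequality[OF u] field_inner_self(2)[of "frame_curl u"]
    unfolding eigenvalue_energy(2)[OF assms] 0 by simp
  then show ?thesis using eigenvalue_energy(1)[OF assms] by simp
qed

section \<open>The differential of a linear function as an eigenform\<close>

text \<open>The linear functions \<open>cnj z\<^sub>1\<close> and \<open>z\<^sub>2\<close> of the complex coordinates. Together their restrictions to the sphere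
  span a space that is invariant under the frame derivatives, so everything below is algebra in this
  two-dimensional space.\<close>

definition lin1 :: "real^4 \<Rightarrow> complex" where "lin1 x = Complex (x $ 1) (- (x $ 2))"
definition lin2 :: "real^4 \<Rightarrow> complex" where "lin2 x = Complex (x $ 3) (x $ 4)"

lemma bounded_linear_lin: "bounded_linear lin1" "bounded_linear lin2"
  by (auto intro!: linearI simp: linear_conv_bounded_linear[symmetric] lin1_def lin2_def complex_eq_iff)

definition sph1 :: "real^4 \<Rightarrow> complex" where "sph1 = linear_on_sphere lin1"
definition sph2 :: "real^4 \<Rightarrow> complex" where "sph2 = linear_on_sphere lin2"

lemma radial_smooth_sph: "radial_smooth sph1" "radial_smooth sph2"
  unfolding sph1_def sph2_def by (intro radial_smooth_linear_on_sphere bounded_linear_lin)+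

lemma frame_deriv_sph:
  assumes "x \<in> S3"
  shows "frame_deriv 1 sph1 x = - \<i> * sph1 x" "frame_deriv 2 sph1 x = - sph2 x" "frame_deriv 3 sph1 x = - \<i> * sph2 x"
    "frame_deriv 1 sph2 x = \<i> * sph2 x" "frame_deriv 2 sph2 x = sph1 x" "frame_deriv 3 sph2 x = - \<i> * sph1 x"
  using assms
  by (simp_all add: sph1_def sph2_def frame_deriv_linear_on_sphere bounded_linear_lin lin1_def lin2_def
      hopf_frame_nth complex_eq_iff del: mem_sphere)

text \<open>The components of the differential of \<open>cnj z\<^sub>1\<close>. The Hopf flow multiplies \<open>cnj z\<^sub>1\<close> by \<open>exp (- \<i> s)\<close>;
  starting from \<open>z\<^sub>1\<close> would reverse the sign of the term linear in \<open>t\<close>.\<close>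

definition sph_grad :: "3 \<Rightarrow> real^4 \<Rightarrow> complex" where
  "sph_grad a x = (if a = 1 then - \<i> * sph1 x else if a = 2 then - sph2 x else - \<i> * sph2 x)"

lemma sph_grad_simps:
  "sph_grad 1 = (\<lambda>x. - \<i> * sph1 x)" "sph_grad 2 = (\<lambda>x. - sph2 x)" "sph_grad 3 = (\<lambda>x. - \<i> * sph2 x)"
  by (simp_all add: sph_grad_def fun_eq_iff)

lemma radial_smooth_sph_grad: "\<forall>a. radial_smooth (sph_grad a)"
  by (simp add: forall_3 sph_grad_simps radial_smooth_sph radial_smooth_mult radial_smooth_minus)

lemma mag_curl_cong:
  assumes "\<forall>a. radial_smooth (u a)" "\<forall>a. radial_smooth (v a)" "\<And>a x. x \<in> S3 \<Longrightarrow> u a x = v a x" "x \<in> S3"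
  shows "mag_curl t u a x = mag_curl t v a x"
  using assms frame_deriv_cong[OF assms(1)[rule_format] assms(4) assms(3) assms(2)[rule_format]]
  by (simp add: mag_curl_def frame_curl_def hopf_cross_def del: mem_sphere)

lemma mag_grad_cong:
  assumes "radial_smooth f" "radial_smooth g" "\<And>x. x \<in> S3 \<Longrightarrow> f x = g x" "x \<in> S3"
  shows "mag_grad t f a x = mag_grad t g a x"
  using assms frame_deriv_cong[OF assms(1,4,3,2)] by (simp add: mag_grad_def del: mem_sphere)

text \<open>This is \<open>\<Delta> - 2 \<i> t L + t\<^sup>2\<close> with \<open>L\<close> the Lie derivative along \<open>Y2\<close>: on the differential of \<open>cnj z\<^sub>1\<close>
  the Hodge Laplacian \<open>\<Delta>\<close> is 3 and \<open>L\<close> is \<open>- \<i>\<close>.\<close>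

lemma mag_lap_sph_grad:
  assumes x: "x \<in> S3"
  shows "mag_lap t sph_grad a x = of_real (3 - 2 * t + t\<^sup>2) * sph_grad a x"
proof -
  note u = radial_smooth_sph_grad
  \<comment> \<open>The magnetic curl of the eigenform; it vanishes for \<open>t = 0\<close>, where the form is closed.\<close>
  define w where "w a x = (if a = 1 then 0 else if a = 2 then - of_real t * sph2 x else - (\<i> * of_real t) * sph2 x)" for a :: 3 and x
  have d: "frame_deriv b (\<lambda>x. c * sph1 x) y = c * frame_deriv b sph1 y"
    "frame_deriv b (\<lambda>x. c * sph2 x) y = c * frame_deriv b sph2 y"
    "frame_deriv b (\<lambda>x. - sph2 x) y = - frame_deriv b sph2 y" if "y \<in> S3" for b c y
    by (rule frame_deriv_cmult[OF radial_smooth_sph(1) that] frame_deriv_cmult[OF radial_smooth_sph(2) that]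
        frame_deriv_minus[OF radial_smooth_sph(2) that])+
  note g = sph_grad_simps
  have w': "w 1 = (\<lambda>x. 0)" "w 2 = (\<lambda>x. - of_real t * sph2 x)" "w 3 = (\<lambda>x. - (\<i> * of_real t) * sph2 x)"
    by (simp_all add: w_def fun_eq_iff)
  have w: "\<forall>a. radial_smooth (w a)"
    by (simp add: forall_3 w' radial_smooth_sph radial_smooth_mult radial_smooth_minus)
  have div: "mag_div t sph_grad y = of_real (t - 3) * sph1 y" if "y \<in> S3" for y
    unfolding mag_div_def frame_div_def sum_3 g d[OF that] frame_deriv_sph[OF that] by (simp add: algebra_simps)
  have curl: "mag_curl t sph_grad b y = w b y" if "y \<in> S3" for b y
    using exhaust_3[of b]
    by (elim disjE; simp only: mag_curl_def frame_curl_def hopf_cross_def cyclic_index g w' d[OF that] frame_deriv_sph[OF that] if_True if_False;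
        simp add: algebra_simps)
  have "mag_lap t sph_grad a x = mag_curl t w a x - mag_grad t (\<lambda>x. of_real (t - 3) * sph1 x) a x"
    unfolding mag_lap_def
    using mag_curl_cong[OF radial_smooth_mag_curl[OF u] w curl x]
      mag_grad_cong[OF radial_smooth_mag_div[OF u] radial_smooth_mult[OF radial_smooth_const radial_smooth_sph(1)] div x]
    by simp
  also have "\<dots> = of_real (3 - 2 * t + t\<^sup>2) * sph_grad a x"
    using exhaust_3[of a]
    by (elim disjE; simp only: mag_curl_def mag_grad_def frame_curl_def hopf_cross_def cyclic_index g w' d[OF x] frame_deriv_sph[OF x]
        frame_deriv_const if_True if_False; simp add: algebra_simps power2_eq_square)
  finally show ?thesis .
qed

lemma sph_grad_nonzero: "\<exists>a. \<exists>x\<in>S3. sph_grad a x \<noteq> 0"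
proof -
  have "sph_grad 1 (axis 1 1) \<noteq> 0"
    by (simp add: sph_grad_def sph1_def linear_on_sphere_def lin1_def complex_eq_iff)
  moreover have "axis 1 1 \<in> S3" by simp
  ultimately show ?thesis by blast
qed

lemma mag_spectrum_sph_grad: "3 - 2 * t + t\<^sup>2 \<in> mag_spectrum t"
  unfolding mag_spectrum_def using radial_smooth_sph_grad sph_grad_nonzero mag_lap_sph_grad by blast

text \<open>An infimum of reals bounds its members from below only if the set is bounded below, which
  \<open>eigenvalue_nonneg\<close> provides.\<close>

lemma magnetic_lambda1_le: "magnetic_lambda1 (\<lambda>x. t *\<^sub>R Y2 x) 1 \<le> 3 - 2 * t + t\<^sup>2"
  unfolding magnetic_lambda1_def smallest_eigenvalue_def eigenvalues_magnetic_laplacian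
proof (rule cInf_lower[OF mag_spectrum_sph_grad])
  show "bdd_below (mag_spectrum t)"
    by (rule bdd_belowI[of _ 0]) (use eigenvalue_nonneg in \<open>unfold mag_spectrum_def, blast\<close>)
qed

lemma hodge_lambda1_ge: "3 \<le> hodge_lambda1 1"
  unfolding hodge_lambda1_def smallest_eigenvalue_def eigenvalues_hodge_laplacian
proof (rule cInf_greatest)
  show "mag_spectrum 0 \<noteq> {}" using mag_spectrum_sph_grad by blast
  show "3 \<le> c" if "c \<in> mag_spectrum 0" for c
    using that hodge_eigenvalue_ge_3 unfolding mag_spectrum_def by blast
qed

lemma smooth_vector_field_Y2: "smooth_vector_field (\<lambda>x. t *\<^sub>R Y2 x)"
proof -
  have l: "bounded_linear Y2" using bounded_linear_hopf_frame[of 1] by (simp add: hopf_frame_1)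
  have "smooth_on (\<lambda>x. t *\<^sub>R (inverse (norm x) *\<^sub>R Y2 x)) (- {0})"
    by (intro smooth_on_bounded_linear[OF bounded_linear_scaleR_right] smooth_on_bounded_bilinear[OF bounded_bilinear_scaleR]
        smooth_on_inverse_norm smooth_on_linear l open_punctured)
  then have "smooth_on (\<lambda>x. t *\<^sub>R Y2 (sgn x)) (- {0})"
    by (simp add: sgn_div_norm linear_cmul[OF bounded_linear.linear[OF l]])
  then show ?thesis
    using Y2_unit_tangent(1) by (simp add: smooth_vector_field_def tangent_space_def)
qed

theorem corollary4p6:
  shows "(\<forall>\<^sub>F t in at_right (0::real). magnetic_lambda1 (\<lambda>x. t *\<^sub>R Y2 x) 1 < hodge_lambda1 1)
    \<and> \<not> (\<forall>X. smooth_vector_field X \<longrightarrow> hodge_lambda1 1 \<le> magnetic_lambda1 X 1)"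
proof -
  have less: "magnetic_lambda1 (\<lambda>x. t *\<^sub>R Y2 x) 1 < hodge_lambda1 1" if "0 < t" "t < 2" for t
  proof -
    have "3 - 2 * t + t\<^sup>2 = 3 - t * (2 - t)" by (simp add: power2_eq_square algebra_simps)
    also have "\<dots> < 3" using that by simp
    finally show ?thesis using magnetic_lambda1_le[of t] hodge_lambda1_ge by linarith
  qed
  have "\<forall>\<^sub>F t in at_right (0::real). magnetic_lambda1 (\<lambda>x. t *\<^sub>R Y2 x) 1 < hodge_lambda1 1"
    using eventually_at_right_real[of 0 2] by (rule eventually_mono) (use less in auto)
  moreover have "\<not> (\<forall>X. smooth_vector_field X \<longrightarrow> hodge_lambda1 1 \<le> magnetic_lambda1 X 1)"
    using less[of 1] smooth_vector_field_Y2[of 1] by force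
  ultimately show ?thesis by blast
qed

end
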